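(* Let $n\ge 1$ and let $\Omega_n=\mathbb{R}[x_1,\dots,x_n]\otimes\wedge\mathbb{R}^n$ be the algebra of polynomial differential forms on $\mathbb{R}^n$ (with $dx_1,\dots,dx_n$ the generators of the exterior factor), on which $S_n$ acts by permuting the indices of the $x_i$ and of the $dx_i$ simultaneously. For integers $r,s\ge 0$ let $H_{r,s}$ be the space of forms $\omega=\sum_{1\le i_1<\dots<i_s\le n}h_{i_1\dots i_s}\,dx_{i_1}\wedge\cdots\wedge dx_{i_s}$ such that every $h_{i_1\dots i_s}$ is an $S_n$-harmonic polynomial homogeneous of degree $r$ and $\delta_j\omega=0$ for $j=0,1,\dots,n-1$. Let $\chi_{r,s}$ be the character of $S_n$ on $H_{r,s}$. Then \[ \sum_{r,s}q^{r}t^{s}\,(\chi_{r,s},\mathrm{sgn})=\prod_{j=1}^{n-1}(q^{j}+t), \] i.e. $\sum_{r,s}q^rt^s\dim\{\omega\in H_{r,s}:\sigma\omega=\mathrm{sgn}(\sigma)\omega\ \forall\sigma\in S_n\}=\prod_{j=1}^{n-1}(q^j+t)$.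
   Context: A polynomial $f\in\mathbb{R}[x_1,\dots,x_n]$ is $S_n$-harmonic if $\sum_{i=1}^n\partial_i^k f=0$ for $k=1,\dots,n$, where $\partial_i=\partial/\partial x_i$. For $l\ge 0$ the operator $\delta_l$ on $\Omega_n$ is defined by $\delta_l\big(h\,dx_{i_1}\wedge\cdots\wedge dx_{i_k}\big)=\sum_{j=1}^n(\partial_j^l h)\,\iota(dx_j)(dx_{i_1}\wedge\cdots\wedge dx_{i_k})$, extended linearly, where for $i_1<\dots<i_k$, $\iota(dx_j)dx_{i_1}\wedge\cdots\wedge dx_{i_k}=0$ if $j\notin\{i_1,\dots,i_k\}$ and equals $(-1)^{r-1}dx_{i_1}\wedge\cdots\wedge\widehat{dx_{i_r}}\wedge\cdots\wedge dx_{i_k}$ if $j=i_r$. The space $\bigoplus_{r,s}H_{r,s}$ is the orthogonal complement (for the tensor product of the Fischer inner product on polynomials and the inner product making the $dx_{i_1}\wedge\cdots\wedge dx_{i_k}$, $i_1<\dots<i_k$, orthonormal) of the ideal of $\Omega_n$ generated by the homogeneous $S_n$-invariants of positive total degree (where $\deg x_i=\deg dx_i=1$). For class functions $f,g$ on $S_n$, $(f,g)=\frac1{n!}\sum_{x\in S_n}f(x)g(x)$; $\mathrm{sgn}$ is the sign character. *)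

theory Defs
  imports Main "HOL-Library.Function_Algebras" "HOL-Combinatorics.Permutations"
    "HOL-Computational_Algebra.Polynomial"
begin

text \<open>Polynomials in x_0,...,x_{n-1} are represented by coefficient functions
  (nat => nat) => real : f alpha is the coefficient of the monomial x^alpha.
  Differential forms are represented by functions nat set => polynomial:
  omega I is the coefficient h_I of dx_{i_1} wedge ... wedge dx_{i_k}, I = {i_1 < ... < i_k}.
  Variables are indexed by 0..n-1 instead of 1..n.\<close>

type_synonym rpoly = "(nat \<Rightarrow> nat) \<Rightarrow> real"
type_synonym rform = "nat set \<Rightarrow> rpoly"

definition pd :: "nat \<Rightarrow> rpoly \<Rightarrow> rpoly" where
  "pd i f = (\<lambda>\<beta>. real (Suc (\<beta> i)) * f (\<beta>(i := Suc (\<beta> i))))"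

definition homog :: "nat \<Rightarrow> nat \<Rightarrow> rpoly \<Rightarrow> bool" where
  "homog n r f \<longleftrightarrow> (\<forall>\<alpha>. f \<alpha> \<noteq> 0 \<longrightarrow> (\<forall>i\<ge>n. \<alpha> i = 0) \<and> (\<Sum>i<n. \<alpha> i) = r)"

definition Sn_harmonic :: "nat \<Rightarrow> rpoly \<Rightarrow> bool" where
  "Sn_harmonic n f \<longleftrightarrow> (\<forall>k\<in>{1..n}. \<forall>\<beta>. (\<Sum>i<n. (pd i ^^ k) f \<beta>) = 0)"

text \<open>delta_l (h dx_I) = sum_j (d_j^l h) iota(dx_j) dx_I; the coefficient at J collects
  I = J + {j}, with sign (-1)^(number of elements of J below j).\<close>
definition delta :: "nat \<Rightarrow> nat \<Rightarrow> rform \<Rightarrow> rform" where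
  "delta n l \<omega> = (\<lambda>J \<beta>. \<Sum>j\<in>{..<n} - J.
      (-1) ^ card {i\<in>J. i < j} * (pd j ^^ l) (\<omega> (insert j J)) \<beta>)"

definition H :: "nat \<Rightarrow> nat \<Rightarrow> nat \<Rightarrow> rform set" where
  "H n r s = {\<omega>. (\<forall>I. \<omega> I \<noteq> (\<lambda>_. 0) \<longrightarrow> I \<subseteq> {..<n} \<and> card I = s)
      \<and> (\<forall>I. homog n r (\<omega> I) \<and> Sn_harmonic n (\<omega> I))
      \<and> (\<forall>l<n. delta n l \<omega> = (\<lambda>_ _. 0))}"

text \<open>Number of inversions of sigma on I (sign of reordering dx_{sigma i_1},...).\<close>
definition inv_count :: "(nat \<Rightarrow> nat) \<Rightarrow> nat set \<Rightarrow> nat" where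
  "inv_count \<sigma> I = card {(a, b). a \<in> I \<and> b \<in> I \<and> a < b \<and> \<sigma> b < \<sigma> a}"

text \<open>Action: sigma x_i = x_{sigma i}, sigma dx_i = dx_{sigma i}.  Coefficient of x^beta in
  sigma f is f (beta o sigma).\<close>
definition form_act :: "(nat \<Rightarrow> nat) \<Rightarrow> rform \<Rightarrow> rform" where
  "form_act \<sigma> \<omega> = (\<lambda>J \<beta>. (-1) ^ inv_count \<sigma> (inv \<sigma> ` J) * \<omega> (inv \<sigma> ` J) (\<beta> \<circ> \<sigma>))"

definition sign_part :: "nat \<Rightarrow> nat \<Rightarrow> nat \<Rightarrow> rform set" where
  "sign_part n r s = {\<omega> \<in> H n r s. \<forall>\<sigma>. \<sigma> permutes {..<n} \<longrightarrow>
      form_act \<sigma> \<omega> = (\<lambda>J \<beta>. of_int (sign \<sigma>) * \<omega> J \<beta>)}"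

definition form_scale :: "real \<Rightarrow> rform \<Rightarrow> rform" where
  "form_scale c \<omega> = (\<lambda>J \<beta>. c * \<omega> J \<beta>)"

definition form_dim :: "rform set \<Rightarrow> nat" where
  "form_dim V = vector_space.dim form_scale V"

end

theory Submission
  imports Defs
begin

text \<open>
  Let \<open>\<Delta>\<close> be the Vandermonde determinant and \<open>d\<^sub>k = \<Sum>\<^sub>j \<partial>\<^sub>j\<^sup>k dx\<^sub>j\<close>. The operator \<open>d\<^sub>k\<close> commutes with the
  action of the symmetric group, and on harmonic forms it anticommutes with every \<open>\<delta>\<^sub>l\<close> when
  \<open>k \<ge> 1\<close>; so the forms \<open>d\<^sub>I \<Delta>\<close> with \<open>I \<subseteq> {1..<n}\<close> are sign-isotypic elements of \<open>H\<close>, of degree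
  \<open>r = \<Sum>({1..<n} - I)\<close> and \<open>s = card I\<close>.

  Conversely, a sign-isotypic \<open>s\<close>-form is determined by its coefficient \<open>h\<close> at
  \<open>dx\<^sub>0 \<and> \<dots> \<and> dx\<^sub>s\<^sub>-\<^sub>1\<close>, which is symmetric in the first \<open>s\<close> variables and antisymmetric in the
  others. As \<open>h\<close> is harmonic, it is determined by its restriction to \<open>x\<^sub>0 = \<dots> = x\<^sub>s\<^sub>-\<^sub>1 = 0\<close>, and all
  exponents are less than \<open>n\<close>. So \<open>h\<close> is determined by its coefficients at exponents that map
  the remaining positions bijectively to a set \<open>A \<subseteq> {..<n}\<close>, and the equation \<open>\<delta>\<^sub>0 \<omega> = 0\<close> makes
  those with \<open>0 \<in> A\<close> sufficient. The coefficient of \<open>d\<^sub>I \<Delta>\<close> belonging to \<open>A\<close> is nonzero iff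
  \<open>A = {..<n} - I\<close>, so the \<open>d\<^sub>I \<Delta>\<close> form a basis.
\<close>

section \<open>Harmonicity in terms of normalised coefficients\<close>

text \<open>Read \<open>c\<close> as the linear functional sending x^\<beta> to
  \<open>c \<beta>\<close>, which is \<beta>! times the coefficient of x^\<beta>. Then
  \<open>inc\<close> is multiplication by x_i^k, dual to the k-th power of the i-th derivative, and
  \<open>harm\<close> says that the functional kills the ideal generated by the power sums.\<close>

definition inc :: "(nat \<Rightarrow> nat) \<Rightarrow> nat \<Rightarrow> nat \<Rightarrow> nat \<Rightarrow> nat" where
  "inc \<beta> i k = \<beta>(i := \<beta> i + k)"

definition harm :: "nat \<Rightarrow> rpoly \<Rightarrow> bool" where
  "harm n c \<longleftrightarrow> (\<forall>k\<in>{1..n}. \<forall>\<beta>. (\<Sum>i<n. c (inc \<beta> i k)) = 0)"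

lemma inc_inc_same: "inc (inc \<beta> i k) i l = inc \<beta> i (k + l)"
  by (auto simp: inc_def fun_eq_iff)

lemma inc_commute: "inc (inc \<beta> i k) j l = inc (inc \<beta> j l) i k"
  by (auto simp: inc_def fun_eq_iff)

lemma inc_apply: "inc \<beta> i k j = (if j = i then \<beta> j + k else \<beta> j)"
  by (simp add: inc_def)

section \<open>Newton's identities: from power sums p_k to elementary symmetric polynomials
  e_m\<close>

lemma sum_subsets_card_Suc:
  fixes g :: "'a set \<Rightarrow> 'a \<Rightarrow> 'b::comm_monoid_add"
  assumes S: "finite S"
  shows "(\<Sum>T | T \<subseteq> S \<and> card T = Suc m. \<Sum>i\<in>T. g T i)
       = (\<Sum>T | T \<subseteq> S \<and> card T = m. \<Sum>i\<in>S - T. g (insert i T) i)"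
proof -
  let ?A = "\<lambda>m. {T. T \<subseteq> S \<and> card T = m}"
  have fin: "finite (?A m)" for m
    by (rule finite_subset[of _ "Pow S"]) (use S in auto)
  have fT: "finite T" if "T \<in> ?A m" for T m
    using that S finite_subset by auto
  have "(\<Sum>T\<in>?A (Suc m). \<Sum>i\<in>T. g T i) = (\<Sum>(T,i)\<in>Sigma (?A (Suc m)) (\<lambda>T. T). g T i)"
    using fin fT by (subst sum.Sigma) blast+
  also have "\<dots> = (\<Sum>(T,i)\<in>Sigma (?A m) (\<lambda>T. S - T). g (insert i T) i)"
    by (rule sum.reindex_bij_witness[of _ "\<lambda>(T,i). (insert i T, i)" "\<lambda>(T,i). (T - {i}, i)"])
      (auto simp: insert_absorb card_insert_if finite_subset[OF _ S])
  also have "\<dots> = (\<Sum>T\<in>?A m. \<Sum>i\<in>S - T. g (insert i T) i)"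
    using fin S by (subst sum.Sigma) blast+
  finally show ?thesis .
qed

text \<open>Multiplication by the squarefree monomial x_T; summed over all T of size m it becomes
  multiplication by e_m.\<close>

definition bump :: "(nat \<Rightarrow> nat) \<Rightarrow> nat set \<Rightarrow> nat \<Rightarrow> nat" where
  "bump \<beta> T = (\<lambda>i. if i \<in> T then Suc (\<beta> i) else \<beta> i)"

lemma inc_bump_insert: "i \<notin> T \<Longrightarrow> inc (bump \<beta> (insert i T)) i k = inc (bump \<beta> T) i (Suc k)"
  by (auto simp: inc_def bump_def fun_eq_iff)

text \<open>\<open>B m k\<close> is the value at the sum of x_T x_i^k over |T| = m and i outside T.
  Since e_{m+1} p_k lies in the ideal, \<open>B (Suc m) k\<close> is minus
  \<open>B m (Suc k)\<close>, which leads down to a power sum at m = 0. Finally m e_m corresponds to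
  B at m - 1 and 1.\<close>

lemma elementary_symmetric_vanish:
  assumes "harm n c" and "1 \<le> m" "m \<le> n"
  shows "(\<Sum>T | T \<subseteq> {..<n} \<and> card T = m. c (bump \<beta> T)) = 0"
proof -
  let ?A = "\<lambda>m. {T. T \<subseteq> {..<n} \<and> card T = m}"
  have fin: "finite (?A m)" for m
    by (rule finite_subset[of _ "Pow {..<n}"]) auto
  define B where "B m k = (\<Sum>T\<in>?A m. \<Sum>i\<in>{..<n} - T. c (inc (bump \<beta> T) i k))" for m k
  have step: "B (Suc m) k + B m (Suc k) = 0" if "1 \<le> k" "k \<le> n" for m k
  proof -
    have "0 = (\<Sum>T\<in>?A (Suc m). \<Sum>i<n. c (inc (bump \<beta> T) i k))"
      using assms(1) that by (auto simp: harm_def)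
    also have "\<dots> = (\<Sum>T\<in>?A (Suc m). (\<Sum>i\<in>{..<n} - T. c (inc (bump \<beta> T) i k))
                      + (\<Sum>i\<in>T. c (inc (bump \<beta> T) i k)))"
      by (intro sum.cong refl sum.subset_diff) auto
    also have "\<dots> = B (Suc m) k + (\<Sum>T\<in>?A (Suc m). \<Sum>i\<in>T. c (inc (bump \<beta> T) i k))"
      by (simp add: sum.distrib B_def)
    also have "(\<Sum>T\<in>?A (Suc m). \<Sum>i\<in>T. c (inc (bump \<beta> T) i k)) = B m (Suc k)"
      unfolding B_def by (subst sum_subsets_card_Suc) (auto intro!: sum.cong simp: inc_bump_insert)
    finally show ?thesis by simp
  qed
  have B0: "B 0 k = 0" if "1 \<le> k" "k \<le> n" for k
  proof -
    have "?A 0 = {{}}" by (auto dest: finite_subset)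
    thus ?thesis using assms(1) that by (simp add: B_def harm_def bump_def)
  qed
  have B: "B m k = 0" if "1 \<le> k" "m + k \<le> n" for m k
    using that
  proof (induction m arbitrary: k)
    case (Suc m)
    then show ?case using step[of k m] Suc.IH[of "Suc k"] by simp
  qed (use B0 in auto)
  obtain m' where m: "m = Suc m'" using assms(2) by (cases m) auto
  have "real m * (\<Sum>T\<in>?A m. c (bump \<beta> T)) = (\<Sum>T\<in>?A m. \<Sum>i\<in>T. c (bump \<beta> T))"
    by (simp add: sum_distrib_left)
  also have "\<dots> = B m' 1"
    unfolding m B_def
    by (subst sum_subsets_card_Suc) (auto intro!: sum.cong arg_cong[of _ _ c] simp: inc_def bump_def)
  also have "\<dots> = 0" using assms m by (intro B) auto
  finally show ?thesis using assms by simp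
qed

text \<open>\<open>x\<^sub>j\<^sup>n\<close> lies in the ideal generated by the invariants of positive degree, because
  \<open>x\<^sub>j\<close> is a root of \<open>\<Prod>\<^sub>i (X - x\<^sub>i)\<close>.\<close>

lemma harm_nilpotent:
  assumes "harm n c" and j: "j < n"
  shows "c (inc \<beta> j n) = 0"
proof -
  let ?S = "{..<n} - {j}"
  let ?A = "\<lambda>m. {T. T \<subseteq> ?S \<and> card T = m}"
  have fin: "finite (?A m)" for m
    by (rule finite_subset[of _ "Pow {..<n}"]) auto
  \<comment> \<open>\<open>F m a\<close> is the value at x_j^a times e_m of the variables other than
    x_j. The recursion holds because e_{m+1} of all variables is e_{m+1} of the others plus x_j
    times e_m of the others.\<close>
  define F where "F m a = (\<Sum>T\<in>?A m. c (inc (bump \<beta> T) j a))" for m a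
  have step: "F (Suc m) a + F m (Suc a) = 0" if "Suc m \<le> n" for m a
  proof -
    have split: "{T. T \<subseteq> {..<n} \<and> card T = Suc m} = ?A (Suc m) \<union> insert j ` ?A m"
    proof (intro equalityI subsetI)
      fix T assume T: "T \<in> {T. T \<subseteq> {..<n} \<and> card T = Suc m}"
      then have "finite T" by (auto intro: finite_subset)
      with T show "T \<in> ?A (Suc m) \<union> insert j ` ?A m"
        by (cases "j \<in> T") (auto intro!: image_eqI[of _ _ "T - {j}"])
    next
      fix T assume T: "T \<in> ?A (Suc m) \<union> insert j ` ?A m"
      have "finite U" if "U \<subseteq> ?S" for U
        using that by (rule finite_subset) simp
      with T j show "T \<in> {T. T \<subseteq> {..<n} \<and> card T = Suc m}"
        by (auto simp: card_insert_if)
    qed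
    have "0 = (\<Sum>T | T \<subseteq> {..<n} \<and> card T = Suc m. c (bump (inc \<beta> j a) T))"
      using assms that by (subst elementary_symmetric_vanish) auto
    also have "\<dots> = (\<Sum>T\<in>?A (Suc m). c (bump (inc \<beta> j a) T))
                   + (\<Sum>T\<in>insert j ` ?A m. c (bump (inc \<beta> j a) T))"
      unfolding split using fin by (intro sum.union_disjoint) auto
    also have "(\<Sum>T\<in>?A (Suc m). c (bump (inc \<beta> j a) T)) = F (Suc m) a"
      unfolding F_def by (intro sum.cong refl arg_cong[of _ _ c]) (auto simp: bump_def inc_def)
    also have "(\<Sum>T\<in>insert j ` ?A m. c (bump (inc \<beta> j a) T))
             = (\<Sum>T\<in>?A m. c (bump (inc \<beta> j a) (insert j T)))"
      by (subst sum.reindex) (auto simp: inj_on_def)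
    also have "\<dots> = F m (Suc a)"
      unfolding F_def by (intro sum.cong refl arg_cong[of _ _ c]) (auto simp: bump_def inc_def)
    finally show ?thesis by simp
  qed
  \<comment> \<open>Start at e_n of the n - 1 other variables, which is an empty sum; end at
    x_j^n.\<close>
  have "F (n - d) d = 0" if "d \<le> n" for d
    using that
  proof (induction d)
    case 0
    have "T \<notin> ?A n" for T
      using card_mono[of ?S T] j by auto
    then have "?A n = {}" by blast
    then show ?case by (simp only: F_def diff_zero sum.empty)
  next
    case (Suc d)
    then show ?case using step[of "n - Suc d" d] by (simp add: Suc_diff_Suc)
  qed
  from this[of n] have "F 0 n = 0" by simp
  moreover have "?A 0 = {{}}" by (auto dest: finite_subset)
  ultimately show ?thesis by (simp add: F_def bump_def)
qed

lemma harm_vanish_ge: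
  assumes "harm n c" "j < n" "n \<le> \<beta> j"
  shows "c \<beta> = 0"
proof -
  have "\<beta> = inc (\<beta>(j := \<beta> j - n)) j n" using assms by (auto simp: inc_def fun_eq_iff)
  then show ?thesis using harm_nilpotent[OF assms(1,2)] by metis
qed

text \<open>For k > n each summand vanishes by itself, so k needs no upper bound. Exponents above n
  arise as k + l in \<open>wedge_contraction\<close>.\<close>

lemma harm_power_sum:
  assumes "harm n c" "1 \<le> k"
  shows "(\<Sum>i<n. c (inc \<beta> i k)) = 0"
proof (cases "k \<le> n")
  case True
  then show ?thesis using assms by (simp add: harm_def)
next
  case False
  then show ?thesis
    using assms(1) by (intro sum.neutral) (auto intro!: harm_vanish_ge[of n c] simp: inc_apply)
qed

lemma inc_transpose:
  assumes "\<gamma> i = \<gamma> j"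
  shows "inc \<gamma> i k = inc \<gamma> j k \<circ> transpose i j"
  using assms by (auto simp: inc_def fun_eq_iff transpose_def)

text \<open>Power sums in the variables indexed by \<open>J\<close> can be traded, modulo invariants, for
  power sums in the other variables; so a harmonic polynomial that is symmetric in the variables in
  \<open>J\<close> is determined by setting them to zero.\<close>

lemma harm_symmetric_zero:
  assumes harm: "harm n c" and J: "J \<subseteq> {..<n}"
    and sym: "\<And>a b \<beta>. a \<in> J \<Longrightarrow> b \<in> J \<Longrightarrow> c (\<beta> \<circ> transpose a b) = c \<beta>"
    and zero: "\<And>\<alpha>. (\<forall>i\<in>J. \<alpha> i = 0) \<Longrightarrow> c \<alpha> = 0"
  shows "c \<alpha> = 0"
proof (induction "card {i\<in>J. \<alpha> i \<noteq> 0}" arbitrary: \<alpha> rule: less_induct)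
  case less
  have finJ: "finite J" using J finite_subset by auto
  show ?case
  proof (cases "\<forall>i\<in>J. \<alpha> i = 0")
    case True
    then show ?thesis by (rule zero)
  next
    case False
    then obtain i0 where i0: "i0 \<in> J" "\<alpha> i0 \<noteq> 0" by auto
    define k where "k = \<alpha> i0"
    define \<gamma> where "\<gamma> = \<alpha>(i0 := 0)"
    have \<alpha>: "\<alpha> = inc \<gamma> i0 k" by (auto simp: \<gamma>_def k_def inc_def)
    \<comment> \<open>The power sum moves the exponent k of i0 to every position i. At the zero
      positions of J this gives \<alpha> up to a transposition; elsewhere J has fewer nonzero
      exponents and the induction applies.\<close>
    have summand: "c (inc \<gamma> i k) = (if i \<in> J \<and> \<gamma> i = 0 then c \<alpha> else 0)" for i
    proof (cases "i \<in> J \<and> \<gamma> i = 0")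
      case True
      have "inc \<gamma> i k = inc \<gamma> i0 k \<circ> transpose i i0"
        using True by (intro inc_transpose) (auto simp: \<gamma>_def)
      then show ?thesis using True sym[of i i0] i0 \<alpha> by simp
    next
      case False
      then have "{j\<in>J. inc \<gamma> i k j \<noteq> 0} \<subset> {i\<in>J. \<alpha> i \<noteq> 0}"
        using i0 by (auto simp: inc_apply \<gamma>_def split: if_splits)
      then have "card {j\<in>J. inc \<gamma> i k j \<noteq> 0} < card {i\<in>J. \<alpha> i \<noteq> 0}"
        using finJ by (intro psubset_card_mono) auto
      then show ?thesis using less False by auto
    qed
    have "0 = (\<Sum>i<n. c (inc \<gamma> i k))"
      using harm_power_sum[OF harm] i0 by (simp add: k_def)
    also have "\<dots> = (\<Sum>i | i < n \<and> i \<in> J \<and> \<gamma> i = 0. c \<alpha>)"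
      by (subst summand) (simp add: sum.inter_filter[symmetric])
    finally have "real (card {i. i < n \<and> i \<in> J \<and> \<gamma> i = 0}) * c \<alpha> = 0" by simp
    moreover have "i0 \<in> {i. i < n \<and> i \<in> J \<and> \<gamma> i = 0}" using i0 J by (auto simp: \<gamma>_def)
    then have "card {i. i < n \<and> i \<in> J \<and> \<gamma> i = 0} \<noteq> 0"
      by (subst card_0_eq) auto
    ultimately show ?thesis by simp
  qed
qed


section \<open>Signs\<close>

text \<open>The sign that sorts dx_j into dx_J, for the wedge product as well as for the
  contraction. It has the same value whether or not j belongs to J.\<close>

definition eps :: "nat set \<Rightarrow> nat \<Rightarrow> real" where
  "eps J j = (-1) ^ card {i\<in>J. i < j}"

text \<open>The sign relating \<sigma> dx_J to the sorted monomial of the image of J.\<close>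

definition inv_sgn :: "(nat \<Rightarrow> nat) \<Rightarrow> nat set \<Rightarrow> real" where
  "inv_sgn \<sigma> J = (-1) ^ inv_count \<sigma> J"

lemma eps_square: "eps J j * eps J j = 1"
  by (simp add: eps_def flip: power_add)

lemma eps_nonzero: "eps J j \<noteq> 0"
  by (simp add: eps_def)

lemma inv_sgn_nonzero: "inv_sgn \<sigma> J \<noteq> 0"
  by (simp add: inv_sgn_def)

text \<open>This sign makes wedge and contraction anticommute: only the larger of i and j has its
  count changed, by the smaller one.\<close>

lemma eps_exchange:
  assumes "finite J" "i \<in> J" "j \<notin> J"
  shows "eps J j * eps (insert j J) i = - (eps J i * eps (J - {i}) j)"
proof (cases "j < i")
  case True
  have "{k \<in> insert j J. k < i} = insert j {k \<in> J. k < i}" "{k \<in> J - {i}. k < j} = {k \<in> J. k < j}"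
    using True by auto
  then show ?thesis using assms by (simp add: eps_def)
next
  case False
  then have *: "i < j" using assms by (metis linorder_neqE_nat)
  have "{k \<in> insert j J. k < i} = {k \<in> J. k < i}" "{k \<in> J. k < j} = insert i {k \<in> J - {i}. k < j}"
    using * assms by auto
  then show ?thesis using assms by (simp add: eps_def)
qed

text \<open>Pulling dx_j to the front and applying \<sigma> can be done in either order.\<close>

lemma inv_sgn_remove:
  assumes fin: "finite J" and j: "j \<in> J" and inj: "inj_on \<sigma> J"
  shows "eps (\<sigma> ` J) (\<sigma> j) * inv_sgn \<sigma> (J - {j}) = inv_sgn \<sigma> J * eps J j"
proof -
  \<comment> \<open>The elements below \<sigma> j after \<sigma> are P1 and P3, those below j before
    are P1 and P2, and the inversions involving j are P2 and P3. Modulo 2 these three counts add up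
    to zero.\<close>
  define P1 where "P1 = {b\<in>J. b < j \<and> \<sigma> b < \<sigma> j}"
  define P2 where "P2 = {b\<in>J. b < j \<and> \<sigma> j < \<sigma> b}"
  define P3 where "P3 = {b\<in>J. j < b \<and> \<sigma> b < \<sigma> j}"
  have finP: "finite P1" "finite P2" "finite P3"
    using fin by (auto simp: P1_def P2_def P3_def)
  have neq: "\<sigma> b \<noteq> \<sigma> j" if "b \<in> J" "b \<noteq> j" for b
    using inj that j by (auto simp: inj_on_def)
  have "b < j \<or> j < b" if "\<sigma> b < \<sigma> j" for b
    using that by (cases b j rule: linorder_cases) auto
  then have "{b\<in>J. \<sigma> b < \<sigma> j} = P1 \<union> P3"
    by (auto simp: P1_def P3_def)
  then have "{i \<in> \<sigma> ` J. i < \<sigma> j} = \<sigma> ` (P1 \<union> P3)"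
    by (simp flip: Collect_conj_eq) auto
  moreover have "card (\<sigma> ` (P1 \<union> P3)) = card (P1 \<union> P3)"
    by (intro card_image inj_on_subset[OF inj]) (auto simp: P1_def P3_def)
  moreover have "card (P1 \<union> P3) = card P1 + card P3"
    using finP by (intro card_Un_disjoint) (auto simp: P1_def P3_def)
  ultimately have c1: "card {i \<in> \<sigma> ` J. i < \<sigma> j} = card P1 + card P3" by simp
  have "\<sigma> b < \<sigma> j \<or> \<sigma> j < \<sigma> b" if "b \<in> J" "b < j" for b
    using neq[of b] that by (auto simp: neq_iff)
  then have "{i\<in>J. i < j} = P1 \<union> P2"
    by (auto simp: P1_def P2_def)
  moreover have "card (P1 \<union> P2) = card P1 + card P2"
    using finP by (intro card_Un_disjoint) (auto simp: P1_def P2_def)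
  ultimately have c2: "card {i\<in>J. i < j} = card P1 + card P2" by simp
  define Q where "Q K = {(a, b). a \<in> K \<and> b \<in> K \<and> a < b \<and> \<sigma> b < \<sigma> a}" for K
  have finQ: "finite (Q K)" if "finite K" for K
    by (rule finite_subset[of _ "K \<times> K"]) (use that in \<open>auto simp: Q_def\<close>)
  have "Q J = Q (J - {j}) \<union> ((\<lambda>b. (b, j)) ` P2 \<union> (\<lambda>b. (j, b)) ` P3)"
    using j by (auto simp: Q_def P2_def P3_def)
  also have "card \<dots> = card (Q (J - {j})) + card ((\<lambda>b. (b, j)) ` P2 \<union> (\<lambda>b. (j, b)) ` P3)"
  proof (rule card_Un_disjoint)
    show "Q (J - {j}) \<inter> ((\<lambda>b. (b, j)) ` P2 \<union> (\<lambda>b. (j, b)) ` P3) = {}"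
      by (auto simp: Q_def)
  qed (use finP finQ fin in auto)
  also have "card ((\<lambda>b. (b, j)) ` P2 \<union> (\<lambda>b. (j, b)) ` P3)
      = card ((\<lambda>b. (b, j)) ` P2) + card ((\<lambda>b. (j, b)) ` P3)"
    using finP by (intro card_Un_disjoint) (auto simp: P2_def)
  also have "\<dots> = card P2 + card P3"
    by (simp add: card_image inj_on_def)
  finally have c3: "inv_count \<sigma> J = inv_count \<sigma> (J - {j}) + (card P2 + card P3)"
    by (simp add: inv_count_def Q_def)
  have parity: "inv_count \<sigma> (J - {j}) + (card P2 + card P3) + (card P1 + card P2)
      = card P1 + card P3 + inv_count \<sigma> (J - {j}) + 2 * card P2" by simp
  show ?thesis
    unfolding eps_def inv_sgn_def c1 c2 c3 power_add[symmetric] parity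
    unfolding power_add power_mult by simp
qed

lemma inv_sgn_strict_mono:
  assumes "strict_mono_on J \<sigma>"
  shows "inv_sgn \<sigma> J = 1"
proof -
  have "{(a, b). a \<in> J \<and> b \<in> J \<and> a < b \<and> \<sigma> b < \<sigma> a} = {}"
    by (fastforce dest: strict_mono_onD[OF assms])
  then show ?thesis by (simp only: inv_sgn_def inv_count_def card.empty power_0)
qed

text \<open>Start from {a, b}, with a single inversion, and add the other elements one at a time: a
  fixed element contributes the same \<open>eps\<close> to both sides of
  \<open>inv_sgn_remove\<close>.\<close>

lemma inv_sgn_transpose:
  assumes "finite J" "a \<in> J" "b \<in> J" "a \<noteq> b"
  shows "inv_sgn (transpose a b) J = -1"
proof -
  have "inv_sgn (transpose a b) (insert a (insert b K)) = -1"
    if "finite K" "a \<notin> K" "b \<notin> K" for K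
    using that
  proof (induction K)
    case empty
    have "{(x, y). x \<in> {a, b} \<and> y \<in> {a, b} \<and> x < y \<and> transpose a b y < transpose a b x}
        = {(min a b, max a b)}"
      using assms(4) by (auto simp: transpose_def)
    then show ?case by (simp add: inv_sgn_def inv_count_def)
  next
    case (insert x K)
    let ?J = "insert a (insert b (insert x K))"
    have x: "transpose a b x = x" using insert by (intro transpose_apply_other) auto
    have rest: "?J - {x} = insert a (insert b K)" using insert by auto
    have img: "transpose a b ` ?J = ?J" by (intro transpose_image_eq) auto
    have "inv_sgn (transpose a b) (insert a (insert b K)) = -1" using insert by simp
    moreover have "eps (transpose a b ` ?J) (transpose a b x) * inv_sgn (transpose a b) (?J - {x})
        = inv_sgn (transpose a b) ?J * eps ?J x"
    proof (rule inv_sgn_remove)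
      show "inj_on (transpose a b) ?J" by (rule inj_on_inverseI[of _ "transpose a b"]) simp
    qed (use insert in auto)
    ultimately have "eps ?J x * (-1) = inv_sgn (transpose a b) ?J * eps ?J x"
      unfolding img x rest by simp
    then have "(inv_sgn (transpose a b) ?J + 1) * eps ?J x = 0"
      by (simp only: distrib_right)
    then show ?case using eps_nonzero[of ?J x] by (simp only: mult_eq_0_iff eq_neg_iff_add_eq_0) simp
  qed
  moreover have "insert a (insert b (J - {a, b})) = J" using assms by auto
  ultimately show ?thesis using assms(1) by (metis DiffD2 finite_Diff insertCI)
qed

section \<open>Alternating forms\<close>

text \<open>The sign-isotypic condition, evaluated at images under \<sigma> so that no inverse
  permutation occurs.\<close>

definition alternating :: "nat \<Rightarrow> rform \<Rightarrow> bool" where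
  "alternating n c \<longleftrightarrow> (\<forall>\<sigma> K \<beta>. \<sigma> permutes {..<n} \<longrightarrow>
     c (\<sigma> ` K) \<beta> = of_int (sign \<sigma>) * inv_sgn \<sigma> K * c K (\<beta> \<circ> \<sigma>))"

lemma alternatingD:
  "alternating n c \<Longrightarrow> \<sigma> permutes {..<n} \<Longrightarrow>
     c (\<sigma> ` K) \<beta> = of_int (sign \<sigma>) * inv_sgn \<sigma> K * c K (\<beta> \<circ> \<sigma>)"
  by (auto simp: alternating_def)

lemma alternating_transpose:
  assumes "alternating n c" "a < n" "b < n" "a \<noteq> b"
  shows "c (transpose a b ` K) \<beta> = - inv_sgn (transpose a b) K * c K (\<beta> \<circ> transpose a b)"
  using alternatingD[OF assms(1) permutes_swap_id[of a "{..<n}" b], of K \<beta>] assms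
  by (simp add: sign_swap_id)

text \<open>Swapping two factors of dx_J costs a sign, which cancels the sign of the
  transposition.\<close>

lemma alternating_symmetric:
  assumes "alternating n c" "J \<subseteq> {..<n}" "a \<in> J" "b \<in> J"
  shows "c J (\<beta> \<circ> transpose a b) = c J \<beta>"
proof (cases "a = b")
  case False
  have "finite J" using assms finite_subset by auto
  moreover have "transpose a b ` J = J" using assms by (intro transpose_image_eq) auto
  ultimately show ?thesis
    using alternating_transpose[of n c a b J \<beta>] assms False by (simp add: inv_sgn_transpose subset_iff)
qed auto

text \<open>Here dx_J is fixed, so the sign of the transposition survives.\<close>

lemma alternating_antisymmetric:
  assumes "alternating n c" "a < n" "b < n" "a \<notin> J" "b \<notin> J" "a \<noteq> b"
  shows "c J (\<beta> \<circ> transpose a b) = - c J \<beta>"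
proof -
  have "transpose a b ` J = J" using assms by (intro transpose_image_eq) auto
  moreover have "strict_mono_on J (transpose a b)"
    using assms by (auto simp: strict_mono_on_def transpose_def)
  ultimately show ?thesis
    using alternating_transpose[of n c a b J \<beta>] assms by (auto simp: inv_sgn_strict_mono)
qed

section \<open>Sign-isotypic harmonic forms and the coefficients that determine them\<close>

definition contraction :: "nat \<Rightarrow> nat \<Rightarrow> rform \<Rightarrow> rform" where
  "contraction n l c J \<beta> = (\<Sum>j\<in>{..<n} - J. eps J j * c (insert j J) (inc \<beta> j l))"

definition supported :: "nat \<Rightarrow> nat \<Rightarrow> nat \<Rightarrow> rform \<Rightarrow> bool" where
  "supported n r s c \<longleftrightarrow> (\<forall>J \<alpha>. c J \<alpha> \<noteq> 0 \<longrightarrow>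
     J \<subseteq> {..<n} \<and> card J = s \<and> (\<forall>i\<ge>n. \<alpha> i = 0) \<and> (\<Sum>i<n. \<alpha> i) = r)"

definition sign_harmonics :: "nat \<Rightarrow> nat \<Rightarrow> nat \<Rightarrow> rform set" where
  "sign_harmonics n r s = {c. supported n r s c \<and> (\<forall>J. harm n (c J))
     \<and> (\<forall>l<n. \<forall>J \<beta>. contraction n l c J \<beta> = 0) \<and> alternating n c}"

lemma ex_permutes_image:
  fixes n :: nat
  assumes "J \<subseteq> {..<n}" "K \<subseteq> {..<n}" "card J = card K"
  obtains \<sigma> where "\<sigma> permutes {..<n}" "\<sigma> ` J = K"
proof -
  have fin: "finite J" using finite_subset[OF assms(1)] by simp
  have fin': "finite K" using finite_subset[OF assms(2)] by simp
  obtain f where f: "bij_betw f J K"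
    using finite_same_card_bij[OF fin fin' assms(3)] by blast
  obtain g where g: "bij_betw g ({..<n} - J) ({..<n} - K)"
    using finite_same_card_bij[of "{..<n} - J" "{..<n} - K"] card_Diff_subset[OF fin assms(1)]
      card_Diff_subset[OF fin' assms(2)] assms(3) by auto
  define \<sigma> where "\<sigma> = (\<lambda>x. if x \<in> J then f x else if x < n then g x else x)"
  have 1: "bij_betw \<sigma> J K" using f by (subst bij_betw_cong[of _ _ f]) (auto simp: \<sigma>_def)
  have 2: "bij_betw \<sigma> ({..<n} - J) ({..<n} - K)"
    using g by (subst bij_betw_cong[of _ _ g]) (auto simp: \<sigma>_def)
  have "bij_betw \<sigma> (J \<union> ({..<n} - J)) (K \<union> ({..<n} - K))"
    by (rule bij_betw_combine[OF 1 2]) auto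
  then have "bij_betw \<sigma> {..<n} {..<n}" using assms by (simp add: Un_absorb1)
  then have "\<sigma> permutes {..<n}"
    by (rule bij_imp_permutes) (use assms in \<open>auto simp: \<sigma>_def\<close>)
  with 1 show ?thesis using that by (auto simp: bij_betw_def)
qed

text \<open>For the top \<open>\<delta>\<^sub>0\<close>-equation at \<open>{0..<s-1}\<close>, symmetry and harmonicity make each of the
  remaining \<open>n - s\<close> terms equal to \<open>1/s\<close> times the first one.\<close>

lemma sign_harmonics_positive_rest:
  assumes c: "c \<in> sign_harmonics n r s" and s: "s \<le> n" and n: "1 \<le> n"
    and zero: "\<And>\<alpha>. (\<forall>i<s. \<alpha> i = 0) \<Longrightarrow> (\<exists>i\<in>{s..<n}. \<alpha> i = 0) \<Longrightarrow> c {..<s} \<alpha> = 0"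
    and \<alpha>0: "\<forall>i<s. \<alpha> i = 0"
  shows "c {..<s} \<alpha> = 0"
proof (cases "\<exists>i\<in>{s..<n}. \<alpha> i = 0")
  case True
  then show ?thesis using zero \<alpha>0 by blast
next
  case pos: False
  from c have harm: "\<And>J. harm n (c J)" and alt: "alternating n c"
    and contr: "\<And>J \<beta>. contraction n 0 c J \<beta> = 0"
    using n by (auto simp: sign_harmonics_def)
  show ?thesis
  proof (cases s)
    case 0
    \<comment> \<open>All n exponents are positive, so one is at least n or, by the pigeonhole
      principle, two coincide.\<close>
    have "\<alpha> ` {..<n} \<subseteq> {1..<n}" if "\<forall>i<n. \<alpha> i < n"
      using pos that 0 by force
    then have "\<not> inj_on \<alpha> {..<n}" if "\<forall>i<n. \<alpha> i < n"
      using that n card_inj_on_le[of \<alpha> "{..<n}" "{1..<n}"] by auto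
    then consider i where "i < n" "n \<le> \<alpha> i" | i j where "i < n" "j < n" "i \<noteq> j" "\<alpha> i = \<alpha> j"
      unfolding inj_on_def by (metis lessThan_iff not_le)
    then show ?thesis
    proof cases
      case 1
      then show ?thesis using harm_vanish_ge[OF harm] by blast
    next
      case 2
      then have "\<alpha> \<circ> transpose i j = \<alpha>" by (auto simp: fun_eq_iff transpose_def)
      then show ?thesis using alternating_antisymmetric[OF alt, of i j "{}" \<alpha>] 2 0 by auto
    qed
  next
    case (Suc t)
    let ?K = "{..<t}"
    have J: "{..<s} = insert t ?K" using Suc by auto
    have tj: "real s * c (insert j ?K) \<alpha> = c {..<s} \<alpha>" if j: "j \<in> {s..<n}" for j
    proof -
      let ?\<tau> = "transpose t j"
      have tK: "?\<tau> ` insert t ?K = insert j ?K"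
        using j Suc by (auto simp: transpose_def image_iff)
      have transfer: "c (insert j ?K) \<beta> = - c {..<s} (\<beta> \<circ> ?\<tau>)" for \<beta>
      proof -
        have "strict_mono_on (insert t ?K) ?\<tau>"
          using j Suc by (auto simp: strict_mono_on_def transpose_def)
        then show ?thesis
          using alternating_transpose[OF alt, of t j "insert t ?K" \<beta>] j Suc s
          by (simp add: tK inv_sgn_strict_mono lessThan_Suc)
      qed
      define k where "k = \<alpha> j"
      define \<gamma> where "\<gamma> = \<alpha>(j := 0)"
      have k: "1 \<le> k" using pos j by (auto simp: k_def Suc_le_eq)
      have \<alpha>: "\<alpha> = inc \<gamma> j k" by (auto simp: \<gamma>_def k_def inc_def)
      have t0: "\<alpha> t = 0" "\<gamma> t = 0" using \<alpha>0 Suc by (auto simp: \<gamma>_def)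
      \<comment> \<open>Apply p_k to the coefficient at \<open>insert j ?K\<close>, moving the
        exponent of x_j to each x_i. The s indices in \<open>insert j ?K\<close> give equal values
        by symmetry, and i = t gives minus the coefficient at \<open>{..<s}\<close>. For any other
        i, transposing t and j leaves exponent 0 at j, so \<open>zero\<close> applies.\<close>
      have summand: "c (insert j ?K) (inc \<gamma> i k)
          = (if i \<in> insert j ?K then c (insert j ?K) \<alpha> else if i = t then - c {..<s} \<alpha> else 0)"
        if i: "i < n" for i
      proof -
        consider "i \<in> insert j ?K" | "i = t" | "i \<in> {s..<n} - {j}"
          using i Suc by fastforce
        then show ?thesis
        proof cases
          case 1
          then have "\<gamma> i = \<gamma> j" using \<alpha>0 Suc by (auto simp: \<gamma>_def)
          then have "inc \<gamma> i k = \<alpha> \<circ> transpose i j" unfolding \<alpha> by (rule inc_transpose)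
          then show ?thesis
            using 1 alternating_symmetric[OF alt, of "insert j ?K" i j \<alpha>] j Suc s by auto
        next
          case 2
          have "inc \<gamma> t k = \<alpha> \<circ> ?\<tau>" unfolding \<alpha>
            using t0 by (intro inc_transpose) (auto simp: \<gamma>_def)
          then show ?thesis using 2 j Suc transfer by (auto simp: comp_assoc)
        next
          case 3
          have "c {..<s} (inc \<gamma> i k \<circ> ?\<tau>) = 0"
            using 3 j \<alpha>0 Suc
            by (intro zero bexI[of _ j]) (auto simp: inc_def \<gamma>_def transpose_def)
          then show ?thesis using 3 j Suc transfer by auto
        qed
      qed
      have "0 = (\<Sum>i<n. c (insert j ?K) (inc \<gamma> i k))"
        using harm_power_sum[OF harm k] by simp
      also have "\<dots> = (\<Sum>i<n. (if i \<in> insert j ?K then c (insert j ?K) \<alpha> else 0)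
                          + (if i = t then - c {..<s} \<alpha> else 0))"
        using j Suc by (intro sum.cong refl) (auto simp: summand)
      also have "\<dots> = (\<Sum>i | i < n \<and> i \<in> insert j ?K. c (insert j ?K) \<alpha>) - c {..<s} \<alpha>"
        using Suc s by (simp add: sum.distrib sum.inter_filter[symmetric] flip: insert_iff)
      also have "{i. i < n \<and> i \<in> insert j ?K} = insert j ?K" using j Suc s by auto
      finally show ?thesis using j Suc by simp
    qed
    have "{..<n} - ?K = insert t {s..<n}" using Suc s by auto
    moreover have "eps ?K j = (-1) ^ t" if "j \<in> insert t {s..<n}" for j
    proof -
      have "{i\<in>?K. i < j} = ?K" using that Suc by auto
      then show ?thesis by (simp add: eps_def)
    qed
    ultimately have "contraction n 0 c ?K \<alpha> = (\<Sum>j\<in>insert t {s..<n}. (-1) ^ t * c (insert j ?K) \<alpha>)"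
      unfolding contraction_def by (intro sum.cong) (auto simp: inc_def)
    also have "\<dots> = (-1) ^ t * (\<Sum>j\<in>insert t {s..<n}. c (insert j ?K) \<alpha>)"
      by (simp add: sum_distrib_left)
    also have "\<dots> = (-1) ^ t * (c {..<s} \<alpha> + (\<Sum>j\<in>{s..<n}. c (insert j ?K) \<alpha>))"
      using Suc by (simp add: lessThan_Suc)
    finally have "c {..<s} \<alpha> + (\<Sum>j\<in>{s..<n}. c (insert j ?K) \<alpha>) = 0"
      using contr[of ?K \<alpha>] by simp
    then have "real s * c {..<s} \<alpha> + (\<Sum>j\<in>{s..<n}. real s * c (insert j ?K) \<alpha>) = 0"
      by (metis distrib_left mult_zero_right sum_distrib_left)
    moreover have "(\<Sum>j\<in>{s..<n}. real s * c (insert j ?K) \<alpha>) = (\<Sum>j\<in>{s..<n}. c {..<s} \<alpha>)"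
      by (intro sum.cong refl tj)
    ultimately have "(real s + real (n - s)) * c {..<s} \<alpha> = 0"
      by (simp add: distrib_right)
    then show ?thesis using Suc by simp
  qed
qed

text \<open>Antisymmetry makes the exponents at \<open>{s..<n}\<close> distinct and nilpotency
  bounds them by n. Then \<open>sign_harmonics_positive_rest\<close> handles exponents without the
  value 0, \<open>harm_symmetric_zero\<close> those not vanishing below s, and permutations carry
  \<open>{..<s}\<close> to any J of size s.\<close>

lemma sign_harmonics_eq_zero:
  assumes c: "c \<in> sign_harmonics n r s" and n: "1 \<le> n"
    and zero: "\<And>\<alpha>. s \<le> n \<Longrightarrow> (\<forall>i<s. \<alpha> i = 0) \<Longrightarrow> (\<forall>i\<ge>n. \<alpha> i = 0) \<Longrightarrow> inj_on \<alpha> {s..<n} \<Longrightarrow>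
      \<alpha> ` {s..<n} \<subseteq> {..<n} \<Longrightarrow> 0 \<in> \<alpha> ` {s..<n} \<Longrightarrow> (\<Sum>i<n. \<alpha> i) = r \<Longrightarrow> c {..<s} \<alpha> = 0"
  shows "c J \<alpha> = 0"
proof (rule ccontr)
  from c have harm: "\<And>J. harm n (c J)" and alt: "alternating n c" and supp: "supported n r s c"
    by (auto simp: sign_harmonics_def)
  assume nz: "c J \<alpha> \<noteq> 0"
  then have J: "J \<subseteq> {..<n}" "card J = s" using supp by (auto simp: supported_def)
  then have s: "s \<le> n" using card_mono[of "{..<n}" J] by auto
  have zero': "c {..<s} \<alpha> = 0" if \<alpha>: "\<forall>i<s. \<alpha> i = 0" "\<exists>i\<in>{s..<n}. \<alpha> i = 0" for \<alpha>
  proof (rule ccontr)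
    assume nz: "c {..<s} \<alpha> \<noteq> 0"
    have "inj_on \<alpha> {s..<n}"
    proof (rule ccontr)
      assume "\<not> inj_on \<alpha> {s..<n}"
      then obtain i j where ij: "i \<in> {s..<n}" "j \<in> {s..<n}" "i \<noteq> j" "\<alpha> i = \<alpha> j"
        by (auto simp: inj_on_def)
      then have "\<alpha> \<circ> transpose i j = \<alpha>" by (auto simp: fun_eq_iff transpose_def)
      then show False using alternating_antisymmetric[OF alt, of i j "{..<s}" \<alpha>] ij nz by auto
    qed
    moreover have "\<alpha> ` {s..<n} \<subseteq> {..<n}"
      using harm_vanish_ge[OF harm[of "{..<s}"], of _ \<alpha>] nz
      by (meson atLeastLessThan_iff image_subsetI lessThan_iff not_le)
    moreover have "0 \<in> \<alpha> ` {s..<n}" using \<alpha> by force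
    moreover have "(\<forall>i\<ge>n. \<alpha> i = 0)" "(\<Sum>i<n. \<alpha> i) = r"
      using supp nz unfolding supported_def by blast+
    ultimately show False using zero[OF s] \<alpha> nz by blast
  qed
  have all: "c {..<s} \<beta> = 0" for \<beta>
  proof (rule harm_symmetric_zero[OF harm, of "{..<s}"])
    show "c {..<s} \<alpha> = 0" if "\<forall>i\<in>{..<s}. \<alpha> i = 0" for \<alpha>
      by (rule sign_harmonics_positive_rest[OF c s n zero']) (use that in auto)
  qed (use s alternating_symmetric[OF alt, of "{..<s}"] in auto)
  obtain \<sigma> where "\<sigma> permutes {..<n}" "\<sigma> ` {..<s} = J"
    by (rule ex_permutes_image[of "{..<s}" n J]) (use J s in auto)
  then show False using alternatingD[OF alt, of \<sigma> "{..<s}" \<alpha>] all nz by auto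
qed

section \<open>Wedging with \<open>\<Sum>\<^sub>j \<partial>\<^sub>j\<^sup>k dx\<^sub>j\<close>\<close>

text \<open>The sign comes from sorting dx_j \<and> dx_{J - {j}} into dx_J.\<close>

definition wedge :: "nat \<Rightarrow> nat \<Rightarrow> rform \<Rightarrow> rform" where
  "wedge n k c J \<beta> =
     (if J \<subseteq> {..<n} then \<Sum>j\<in>J. eps J j * c (J - {j}) (inc \<beta> j k) else 0)"

lemma sum_inc:
  assumes "j < n"
  shows "(\<Sum>i<n. inc \<beta> j k i) = (\<Sum>i<n. \<beta> i) + k"
proof -
  have "(\<Sum>i<n. inc \<beta> j k i) = (\<Sum>i<n. \<beta> i + (if i = j then k else 0))"
    by (intro sum.cong) (auto simp: inc_apply)
  then show ?thesis using assms by (simp add: sum.distrib)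
qed

lemma wedge_supported:
  assumes "supported n (r + k) s c"
  shows "supported n r (Suc s) (wedge n k c)"
  unfolding supported_def
proof (intro allI impI)
  fix J \<beta> assume nz: "wedge n k c J \<beta> \<noteq> 0"
  then have J: "J \<subseteq> {..<n}" by (auto simp: wedge_def split: if_splits)
  with nz have "(\<Sum>j\<in>J. eps J j * c (J - {j}) (inc \<beta> j k)) \<noteq> 0" by (simp add: wedge_def)
  then obtain j where j: "j \<in> J" "c (J - {j}) (inc \<beta> j k) \<noteq> 0"
    by (metis (no_types, lifting) mult_zero_right sum.not_neutral_contains_not_neutral)
  then have "card (J - {j}) = s" "\<forall>i\<ge>n. inc \<beta> j k i = 0" "(\<Sum>i<n. inc \<beta> j k i) = r + k"
    using assms unfolding supported_def by blast+
  moreover have "finite J" "j < n" using J j finite_subset[OF J] by auto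
  then have "card J = Suc (card (J - {j}))" "(\<Sum>i<n. inc \<beta> j k i) = (\<Sum>i<n. \<beta> i) + k"
    using j by (simp_all only: card_Suc_Diff1 sum_inc)
  moreover have "\<forall>i\<ge>n. \<beta> i = 0"
    using \<open>\<forall>i\<ge>n. inc \<beta> j k i = 0\<close> \<open>j < n\<close> by (auto simp: inc_apply)
  ultimately show "J \<subseteq> {..<n} \<and> card J = Suc s \<and> (\<forall>i\<ge>n. \<beta> i = 0) \<and> (\<Sum>i<n. \<beta> i) = r"
    using J by simp
qed

lemma wedge_harm:
  assumes "\<And>J. harm n (c J)"
  shows "harm n (wedge n k c J)"
  unfolding harm_def
proof (intro ballI allI)
  fix l \<beta> assume l: "l \<in> {1..n}"
  show "(\<Sum>i<n. wedge n k c J (inc \<beta> i l)) = 0"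
  proof (cases "J \<subseteq> {..<n}")
    case True
    then have "(\<Sum>i<n. wedge n k c J (inc \<beta> i l))
        = (\<Sum>j\<in>J. \<Sum>i<n. eps J j * c (J - {j}) (inc (inc \<beta> i l) j k))"
      by (subst sum.swap) (simp add: wedge_def)
    also have "\<dots> = (\<Sum>j\<in>J. eps J j * (\<Sum>i<n. c (J - {j}) (inc (inc \<beta> j k) i l)))"
      by (simp add: sum_distrib_left inc_commute[of \<beta> _ l])
    also have "\<dots> = 0" using assms l by (simp add: harm_def)
    finally show ?thesis .
  qed (simp add: wedge_def)
qed

text \<open>On harmonic forms \<open>\<delta>\<^sub>l\<close> anticommutes with the wedge operator: the anticommutator is
  \<open>\<Sum>\<^sub>j \<partial>\<^sub>j\<^sup>k\<^sup>+\<^sup>l\<close>.\<close>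

lemma wedge_contraction:
  assumes harm: "\<And>J. harm n (c J)" and contr: "\<And>J \<beta>. contraction n l c J \<beta> = 0" and k: "1 \<le> k"
  shows "contraction n l (wedge n k c) J \<beta> = 0"
proof (cases "J \<subseteq> {..<n}")
  case J: True
  then have fin: "finite J" by (meson finite_lessThan finite_subset)
  let ?T = "\<lambda>i j. c (insert j (J - {i})) (inc (inc \<beta> i k) j l)"
  \<comment> \<open>This is the vanishing contraction at \<open>J - {i}\<close> with its term j = i
    split off.\<close>
  have inner: "(\<Sum>j\<in>{..<n} - J. eps (J - {i}) j * ?T i j) = - (eps J i * c J (inc \<beta> i (k + l)))"
    if i: "i \<in> J" for i
  proof -
    have eq: "{..<n} - (J - {i}) = insert i ({..<n} - J)" using i J by auto
    have "{k \<in> J - {i}. k < i} = {k \<in> J. k < i}" by auto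
    then have "eps (J - {i}) i = eps J i" by (simp add: eps_def)
    then have "contraction n l c (J - {i}) (inc \<beta> i k)
        = eps J i * c J (inc \<beta> i (k + l)) + (\<Sum>j\<in>{..<n} - J. eps (J - {i}) j * ?T i j)"
      unfolding contraction_def eq using i by (subst sum.insert) (auto simp: insert_absorb inc_inc_same)
    then show ?thesis using contr[of "J - {i}" "inc \<beta> i k"] by simp
  qed
  \<comment> \<open>Removing j itself from \<open>insert j J\<close> yields the shift by k + l; the
    other removals change sign by \<open>eps_exchange\<close>.\<close>
  have wedge_eq: "eps J j * wedge n k c (insert j J) (inc \<beta> j l)
      = c J (inc \<beta> j (k + l)) - (\<Sum>i\<in>J. eps J i * (eps (J - {i}) j * ?T i j))"
    if j: "j \<in> {..<n} - J" for j
  proof -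
    have "{k \<in> insert j J. k < j} = {k \<in> J. k < j}" by auto
    then have ej: "eps (insert j J) j = eps J j" by (simp add: eps_def)
    have "eps J j * wedge n k c (insert j J) (inc \<beta> j l)
       = eps J j * (eps J j * c J (inc (inc \<beta> j l) j k)
          + (\<Sum>i\<in>J. eps (insert j J) i * c (insert j J - {i}) (inc (inc \<beta> j l) i k)))"
      using j J fin by (simp add: wedge_def ej)
    also have "\<dots> = eps J j * eps J j * c J (inc \<beta> j (k + l))
          + (\<Sum>i\<in>J. eps J j * eps (insert j J) i * c (insert j J - {i}) (inc (inc \<beta> j l) i k))"
      by (simp add: distrib_left sum_distrib_left inc_inc_same add.commute mult.assoc)
    also have "(\<Sum>i\<in>J. eps J j * eps (insert j J) i * c (insert j J - {i}) (inc (inc \<beta> j l) i k))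
        = (\<Sum>i\<in>J. - (eps J i * (eps (J - {i}) j * ?T i j)))"
    proof (intro sum.cong refl)
      fix i assume i: "i \<in> J"
      have "insert j J - {i} = insert j (J - {i})" using i j by auto
      then show "eps J j * eps (insert j J) i * c (insert j J - {i}) (inc (inc \<beta> j l) i k)
          = - (eps J i * (eps (J - {i}) j * ?T i j))"
        using eps_exchange[OF fin i, of j] j by (simp add: inc_commute[of \<beta> j l])
    qed
    finally show ?thesis by (simp add: eps_square sum_negf)
  qed
  have "contraction n l (wedge n k c) J \<beta>
      = (\<Sum>j\<in>{..<n} - J. c J (inc \<beta> j (k + l)))
        - (\<Sum>j\<in>{..<n} - J. \<Sum>i\<in>J. eps J i * (eps (J - {i}) j * ?T i j))"
    unfolding contraction_def by (simp add: wedge_eq sum_subtractf)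
  also have "(\<Sum>j\<in>{..<n} - J. \<Sum>i\<in>J. eps J i * (eps (J - {i}) j * ?T i j))
      = (\<Sum>i\<in>J. eps J i * (\<Sum>j\<in>{..<n} - J. eps (J - {i}) j * ?T i j))"
    by (subst sum.swap) (simp add: sum_distrib_left)
  also have "\<dots> = (\<Sum>i\<in>J. - c J (inc \<beta> i (k + l)))"
    by (intro sum.cong refl) (simp add: inner eps_square flip: mult.assoc)
  also have "(\<Sum>j\<in>{..<n} - J. c J (inc \<beta> j (k + l))) - (\<Sum>i\<in>J. - c J (inc \<beta> i (k + l)))
      = (\<Sum>i<n. c J (inc \<beta> i (k + l)))"
    using J by (subst sum.subset_diff[of J "{..<n}"]) (auto simp: sum_negf)
  also have "\<dots> = 0" using harm_power_sum[OF harm] k by simp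
  finally show ?thesis .
qed (simp add: contraction_def wedge_def)

text \<open>The operator commutes with permutations; \<open>inv_sgn_remove\<close> matches the
  reordering signs.\<close>

lemma wedge_alternating:
  assumes alt: "alternating n c"
  shows "alternating n (wedge n k c)"
  unfolding alternating_def
proof (intro allI impI)
  fix \<sigma> J \<beta> assume \<sigma>: "\<sigma> permutes {..<n}"
  then have inj: "inj \<sigma>" by (rule permutes_inj)
  have sub: "\<sigma> ` J \<subseteq> {..<n} \<longleftrightarrow> J \<subseteq> {..<n}"
    using permutes_in_image[OF \<sigma>] by blast
  show "wedge n k c (\<sigma> ` J) \<beta> = of_int (sign \<sigma>) * inv_sgn \<sigma> J * wedge n k c J (\<beta> \<circ> \<sigma>)"
  proof (cases "J \<subseteq> {..<n}")
    case True
    then have fin: "finite J" by (meson finite_lessThan finite_subset)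
    have "wedge n k c (\<sigma> ` J) \<beta>
        = (\<Sum>j\<in>J. eps (\<sigma> ` J) (\<sigma> j) * c (\<sigma> ` J - {\<sigma> j}) (inc \<beta> (\<sigma> j) k))"
      using True sub inj_on_subset[OF inj, of J] by (simp add: wedge_def sum.reindex)
    also have "\<dots> = (\<Sum>j\<in>J. of_int (sign \<sigma>) * inv_sgn \<sigma> J
        * (eps J j * c (J - {j}) (inc (\<beta> \<circ> \<sigma>) j k)))"
    proof (intro sum.cong refl)
      fix j assume j: "j \<in> J"
      have "\<sigma> ` J - {\<sigma> j} = \<sigma> ` (J - {j})" using inj by (auto simp: inj_def)
      then have "c (\<sigma> ` J - {\<sigma> j}) (inc \<beta> (\<sigma> j) k)
          = of_int (sign \<sigma>) * inv_sgn \<sigma> (J - {j}) * c (J - {j}) (inc \<beta> (\<sigma> j) k \<circ> \<sigma>)"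
        by (simp add: alternatingD[OF alt \<sigma>])
      also have "inc \<beta> (\<sigma> j) k \<circ> \<sigma> = inc (\<beta> \<circ> \<sigma>) j k"
        using inj by (auto simp: inc_def fun_eq_iff inj_def)
      finally show "eps (\<sigma> ` J) (\<sigma> j) * c (\<sigma> ` J - {\<sigma> j}) (inc \<beta> (\<sigma> j) k)
          = of_int (sign \<sigma>) * inv_sgn \<sigma> J * (eps J j * c (J - {j}) (inc (\<beta> \<circ> \<sigma>) j k))"
        using inv_sgn_remove[OF fin j inj_on_subset[OF inj subset_UNIV]]
        by (simp add: mult_ac)
    qed
    finally show ?thesis using True by (simp add: wedge_def sum_distrib_left)
  next
    case False
    then show ?thesis using sub by (simp add: wedge_def)
  qed
qed

text \<open>When \<alpha> vanishes on J, the transposition of i and j turns the summand of one into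
  that of the other, so all summands agree and no cancellation can occur.\<close>

lemma wedge_eval:
  assumes alt: "alternating n c" and J: "J \<subseteq> {..<n}" and i: "i \<in> J" and zero: "\<forall>j\<in>J. \<alpha> j = 0"
  shows "wedge n k c J \<alpha> = real (card J) * (eps J i * c (J - {i}) (inc \<alpha> i k))"
proof -
  have fin: "finite J" using J finite_subset by auto
  have "eps J j * c (J - {j}) (inc \<alpha> j k) = eps J i * c (J - {i}) (inc \<alpha> i k)" if j: "j \<in> J" for j
  proof (cases "j = i")
    case False
    let ?\<tau> = "transpose i j"
    have img: "?\<tau> ` J = J" using i j by (intro transpose_image_eq) auto
    have inj: "inj_on ?\<tau> J" by (rule inj_on_inverseI[of _ ?\<tau>]) simp
    have img': "?\<tau> ` (J - {j}) = J - {i}"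
      using inj_on_image_set_diff[OF inj, of J "{j}"] j img by simp
    have sgn: "eps J i * inv_sgn ?\<tau> (J - {j}) = - eps J j"
      using inv_sgn_remove[OF fin j inj] inv_sgn_transpose[OF fin i j] False by (simp add: img)
    have "inc \<alpha> j k = inc \<alpha> i k \<circ> ?\<tau>"
      using inc_transpose[of \<alpha> j i k] zero i j by (simp add: transpose_commute)
    then have "c (J - {i}) (inc \<alpha> i k) = - inv_sgn ?\<tau> (J - {j}) * c (J - {j}) (inc \<alpha> j k)"
      using alternating_transpose[OF alt, of i j "J - {j}" "inc \<alpha> i k"] i j J False img'
      by (auto simp: subset_iff)
    then have "eps J i * c (J - {i}) (inc \<alpha> i k)
        = - (eps J i * inv_sgn ?\<tau> (J - {j})) * c (J - {j}) (inc \<alpha> j k)" by simp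
    then show ?thesis by (simp add: sgn)
  qed simp
  then have "(\<Sum>j\<in>J. eps J j * c (J - {j}) (inc \<alpha> j k))
      = (\<Sum>j\<in>J. eps J i * c (J - {i}) (inc \<alpha> i k))"
    by (intro sum.cong) auto
  then show ?thesis using J by (simp add: wedge_def)
qed

section \<open>The Vandermonde determinant and its descendants\<close>

text \<open>An exponent vanishes from n on, a permutation is the identity there; this passes from
  the former to the latter so that \<open>sign\<close> applies.\<close>

definition extend_id :: "nat \<Rightarrow> (nat \<Rightarrow> nat) \<Rightarrow> nat \<Rightarrow> nat" where
  "extend_id n \<alpha> = (\<lambda>i. if i < n then \<alpha> i else i)"

text \<open>Every monomial of the Vandermonde determinant has the same \<alpha>! = 0! 1! ... (n-1)!.
  This common factor is dropped from the normalised coefficients.\<close>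

definition vandermonde :: "nat \<Rightarrow> rform" where
  "vandermonde n J \<alpha> = (if J = {} \<and> (\<forall>i\<ge>n. \<alpha> i = 0) \<and> extend_id n \<alpha> permutes {..<n}
     then of_int (sign (extend_id n \<alpha>)) else 0)"

lemma extend_id_permutes_iff: "extend_id n \<alpha> permutes {..<n} \<longleftrightarrow> bij_betw \<alpha> {..<n} {..<n}"
proof -
  have "bij_betw (extend_id n \<alpha>) {..<n} {..<n} \<longleftrightarrow> bij_betw \<alpha> {..<n} {..<n}"
    by (intro bij_betw_cong) (auto simp: extend_id_def)
  then show ?thesis
    using permutes_imp_bij[of "extend_id n \<alpha>" "{..<n}"]
      bij_imp_permutes[of "extend_id n \<alpha>" "{..<n}"]
    by (auto simp: extend_id_def)
qed

lemma vandermonde_nonzero_iff: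
  "vandermonde n J \<alpha> \<noteq> 0 \<longleftrightarrow> J = {} \<and> (\<forall>i\<ge>n. \<alpha> i = 0) \<and> bij_betw \<alpha> {..<n} {..<n}"
  by (auto simp: vandermonde_def extend_id_permutes_iff sign_def)

lemma vandermonde_supported: "supported n (\<Sum>{..<n}) 0 (vandermonde n)"
  unfolding supported_def vandermonde_nonzero_iff
  using sum.reindex_bij_betw[of _ "{..<n}" "{..<n}" "\<lambda>x. x"] by auto

lemma vandermonde_alternating: "alternating n (vandermonde n)"
  unfolding alternating_def
proof (intro allI impI)
  fix \<sigma> K \<beta> assume \<sigma>: "\<sigma> permutes {..<n}"
  show "vandermonde n (\<sigma> ` K) \<beta> = of_int (sign \<sigma>) * inv_sgn \<sigma> K * vandermonde n K (\<beta> \<circ> \<sigma>)"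
  proof (cases "K = {} \<and> extend_id n \<beta> permutes {..<n}")
    case True
    have ext: "extend_id n (\<beta> \<circ> \<sigma>) = extend_id n \<beta> \<circ> \<sigma>"
      using permutes_in_image[OF \<sigma>] permutes_not_in[OF \<sigma>] by (auto simp: extend_id_def fun_eq_iff)
    have zero: "(\<forall>i\<ge>n. (\<beta> \<circ> \<sigma>) i = 0) \<longleftrightarrow> (\<forall>i\<ge>n. \<beta> i = 0)"
      using permutes_not_in[OF \<sigma>] by auto
    have perm: "permutation \<sigma>" "permutation (extend_id n \<beta>)"
      using \<sigma> True by (auto intro: permutes_imp_permutation)
    have "extend_id n (\<beta> \<circ> \<sigma>) permutes {..<n}"
      unfolding ext using \<sigma> True by (intro permutes_compose) auto
    moreover have "sign (extend_id n (\<beta> \<circ> \<sigma>)) = sign (extend_id n \<beta>) * sign \<sigma>"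
      unfolding ext using perm by (intro sign_compose)
    moreover have "real_of_int (sign \<sigma>) * real_of_int (sign \<sigma>) = 1"
      by (simp add: sign_def)
    ultimately show ?thesis
      using True unfolding vandermonde_def zero by (simp add: inv_sgn_def inv_count_def)
  next
    case False
    have "bij_betw \<beta> {..<n} {..<n} \<longleftrightarrow> bij_betw (\<beta> \<circ> \<sigma>) {..<n} {..<n}"
      using bij_betw_comp_iff[OF permutes_imp_bij[OF \<sigma>]] by blast
    then have "vandermonde n (\<sigma> ` K) \<beta> = 0" "vandermonde n K (\<beta> \<circ> \<sigma>) = 0"
      using False by (auto simp: vandermonde_def extend_id_permutes_iff)
    then show ?thesis by simp
  qed
qed

text \<open>If \<beta> is injective, raising one exponent cannot give a permutation, since the new
  value would already be taken. If \<beta> takes a value at both a and b, only the terms i = a and i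
  = b can be nonzero, and they cancel by antisymmetry.\<close>

lemma vandermonde_harm: "harm n (vandermonde n J)"
  unfolding harm_def
proof (intro ballI allI)
  fix k \<beta> assume k: "k \<in> {1..n}"
  show "(\<Sum>i<n. vandermonde n J (inc \<beta> i k)) = 0"
  proof (cases "J = {}")
    case J: True
    show ?thesis
    proof (cases "inj_on \<beta> {..<n}")
      case True
      have "vandermonde n J (inc \<beta> i k) = 0" if i: "i < n" for i
      proof (rule ccontr)
        assume "vandermonde n J (inc \<beta> i k) \<noteq> 0"
        then have bij: "bij_betw (inc \<beta> i k) {..<n} {..<n}" by (simp add: vandermonde_nonzero_iff)
        then have lt: "inc \<beta> i k j < n" if "j < n" for j using that by (auto simp: bij_betw_def)
        have "\<beta> j < n" if "j < n" for j
          using lt[OF that] by (auto simp: inc_apply split: if_splits)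
        then have "\<beta> ` {..<n} = {..<n}"
          using True by (intro card_subset_eq) (auto simp: card_image)
        moreover have "\<beta> i + k < n" using lt[OF i] by (simp add: inc_apply)
        ultimately obtain j where j: "j < n" "\<beta> j = \<beta> i + k"
          by (metis imageE lessThan_iff)
        then have "j \<noteq> i" using k by auto
        then have "inc \<beta> i k j = inc \<beta> i k i" using j by (simp add: inc_apply)
        then show False
          using inj_onD[OF bij_betw_imp_inj_on[OF bij], of j i] i j \<open>j \<noteq> i\<close> by simp
      qed
      then show ?thesis by simp
    next
      case False
      then obtain a b where ab: "a < n" "b < n" "a \<noteq> b" "\<beta> a = \<beta> b"
        by (auto simp: inj_on_def)
      have "vandermonde n J (inc \<beta> i k) = 0" if "i < n" "i \<noteq> a" "i \<noteq> b" for i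
      proof (rule ccontr)
        assume "vandermonde n J (inc \<beta> i k) \<noteq> 0"
        then have "inj_on (inc \<beta> i k) {..<n}" by (simp add: vandermonde_nonzero_iff bij_betw_def)
        moreover have "inc \<beta> i k a = inc \<beta> i k b" using ab that by (simp add: inc_apply)
        ultimately show False using inj_onD[of "inc \<beta> i k" "{..<n}" a b] ab by simp
      qed
      then have "(\<Sum>i<n. vandermonde n J (inc \<beta> i k)) = (\<Sum>i\<in>{a, b}. vandermonde n J (inc \<beta> i k))"
        using ab by (intro sum.mono_neutral_right) auto
      also have "\<dots> = 0"
        using alternating_antisymmetric[OF vandermonde_alternating, of a n b "{}" "inc \<beta> b k"] ab J
          inc_transpose[of \<beta> a b k] by simp
      finally show ?thesis .
    qed
  qed (simp add: vandermonde_def)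
qed

section \<open>Wedge operators applied to the Vandermonde determinant\<close>

definition descendant :: "nat \<Rightarrow> nat list \<Rightarrow> rform" where
  "descendant n ks = foldr (wedge n) ks (vandermonde n)"

lemma descendant_simps:
  "descendant n [] = vandermonde n"
  "descendant n (k # ks) = wedge n k (descendant n ks)"
  by (simp_all add: descendant_def)

lemma descendant_alternating: "alternating n (descendant n ks)"
  by (induction ks) (auto simp: descendant_simps vandermonde_alternating wedge_alternating)

lemma descendant_harm: "harm n (descendant n ks J)"
  by (induction ks arbitrary: J) (auto simp: descendant_simps vandermonde_harm wedge_harm)

lemma descendant_contraction:
  "\<forall>k\<in>set ks. 1 \<le> k \<Longrightarrow> contraction n l (descendant n ks) J \<beta> = 0"
proof (induction ks arbitrary: J \<beta>)
  case Nil
  then show ?case by (simp add: descendant_simps contraction_def vandermonde_def)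
next
  case (Cons k ks)
  then show ?case by (auto simp: descendant_simps intro!: wedge_contraction descendant_harm)
qed

lemma descendant_supported:
  "r + sum_list ks = \<Sum>{..<n} \<Longrightarrow> supported n r (length ks) (descendant n ks)"
proof (induction ks arbitrary: r)
  case Nil
  then show ?case using vandermonde_supported[of n] by (simp add: descendant_simps)
next
  case (Cons k ks)
  then show ?case by (auto simp: descendant_simps add.assoc intro!: wedge_supported)
qed

lemma descendant_sign_harmonics:
  assumes "\<forall>k\<in>set ks. 1 \<le> k" "r + sum_list ks = \<Sum>{..<n}"
  shows "descendant n ks \<in> sign_harmonics n r (length ks)"
  using assms
  by (simp add: sign_harmonics_def descendant_supported descendant_harm descendant_contraction
      descendant_alternating)

text \<open>By \<open>wedge_eval\<close>, each wedge moves one position from J to the remaining ones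
  and gives it the exponent k. At the end the Vandermonde coefficient requires a bijection, so the
  original positions outside J take exactly the values not in \<open>ks\<close>.\<close>

lemma descendant_nonzero_iff:
  assumes "distinct ks" "set ks \<subseteq> {..<n}" "J \<subseteq> {..<n}" "\<forall>j\<in>J. \<alpha> j = 0" "\<forall>i\<ge>n. \<alpha> i = 0"
  shows "descendant n ks J \<alpha> \<noteq> 0 \<longleftrightarrow>
    card J = length ks \<and> bij_betw \<alpha> ({..<n} - J) ({..<n} - set ks)"
  using assms
proof (induction ks arbitrary: J \<alpha>)
  case Nil
  have "finite J" using finite_subset[OF Nil(3)] by simp
  then have "card J = 0 \<longleftrightarrow> J = {}" by auto
  then show ?case using Nil by (auto simp: descendant_simps vandermonde_nonzero_iff)
next
  case (Cons k ks)
  then have fin: "finite J" by (meson finite_lessThan finite_subset)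
  show ?case
  proof (cases "J = {}")
    case True
    then show ?thesis by (simp add: descendant_simps wedge_def)
  next
    case False
    then obtain j where j: "j \<in> J" by auto
    have c: "card J = Suc (card (J - {j}))" using fin j by (simp only: card_Suc_Diff1)
    have "descendant n (k # ks) J \<alpha> \<noteq> 0 \<longleftrightarrow> descendant n ks (J - {j}) (inc \<alpha> j k) \<noteq> 0"
      using wedge_eval[OF descendant_alternating Cons.prems(3) j Cons.prems(4), of k ks] fin False
      by (simp add: descendant_simps eps_nonzero)
    also have "\<dots> \<longleftrightarrow> card (J - {j}) = length ks
        \<and> bij_betw (inc \<alpha> j k) ({..<n} - (J - {j})) ({..<n} - set ks)"
      using Cons.prems j by (intro Cons.IH) (auto simp: inc_apply)
    \<comment> \<open>Since \<alpha> j = 0, the new value at j is k; adding j to the domain and k to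
      the range does not affect bijectivity.\<close>
    also have "{..<n} - (J - {j}) = ({..<n} - J) \<union> {j}" using j Cons.prems by auto
    also have "{..<n} - set ks = ({..<n} - set (k # ks)) \<union> {inc \<alpha> j k j}"
      using Cons.prems j by (auto simp: inc_apply)
    also have "bij_betw (inc \<alpha> j k) (({..<n} - J) \<union> {j}) (({..<n} - set (k # ks)) \<union> {inc \<alpha> j k j})
        \<longleftrightarrow> bij_betw (inc \<alpha> j k) ({..<n} - J) ({..<n} - set (k # ks))"
      using Cons.prems j by (intro notIn_Un_bij_betw3[symmetric]) (auto simp: inc_apply)
    also have "\<dots> \<longleftrightarrow> bij_betw \<alpha> ({..<n} - J) ({..<n} - set (k # ks))"
      using j by (intro bij_betw_cong) (auto simp: inc_apply)
    finally show ?thesis using c by simp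
  qed
qed

section \<open>Normalising coefficients\<close>

definition weight :: "nat \<Rightarrow> (nat \<Rightarrow> nat) \<Rightarrow> real" where
  "weight n \<alpha> = (\<Prod>i<n. fact (\<alpha> i))"

text \<open>Multiplying the coefficient of \<open>x\<^sup>\<alpha>\<close> by \<open>\<alpha>!\<close> turns \<open>\<partial>\<^sub>j\<^sup>k\<close> into the shift \<open>\<lambda>\<beta>. inc \<beta> j k\<close>.\<close>

definition normal :: "nat \<Rightarrow> rform \<Rightarrow> rform" where
  "normal n \<omega> J \<alpha> = weight n \<alpha> * \<omega> J \<alpha>"

lemma weight_nonzero: "weight n \<alpha> \<noteq> 0"
  by (simp add: weight_def)

lemma weight_permute: "\<sigma> permutes {..<n} \<Longrightarrow> weight n (\<beta> \<circ> \<sigma>) = weight n \<beta>"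
  unfolding weight_def
  using prod.permute[of \<sigma> "{..<n}" "\<lambda>i. fact (\<beta> i) :: real"] by (simp add: comp_def)

lemma fact_pd_power: "fact (\<beta> j) * (pd j ^^ k) f \<beta> = fact (\<beta> j + k) * f (inc \<beta> j k)"
proof (induction k arbitrary: \<beta>)
  case 0
  then show ?case by (simp add: inc_def)
next
  case (Suc k)
  have "(pd j ^^ Suc k) f \<beta> = real (Suc (\<beta> j)) * (pd j ^^ k) f (inc \<beta> j 1)"
    by (simp add: pd_def inc_def)
  then have "fact (\<beta> j) * (pd j ^^ Suc k) f \<beta> = fact (inc \<beta> j 1 j) * (pd j ^^ k) f (inc \<beta> j 1)"
    by (simp add: inc_apply mult_ac)
  also have "\<dots> = fact (\<beta> j + Suc k) * f (inc \<beta> j (Suc k))"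
    by (subst Suc.IH) (simp add: inc_inc_same inc_apply)
  finally show ?case .
qed

lemma weight_pd_power:
  assumes "j < n"
  shows "weight n \<beta> * (pd j ^^ k) f \<beta> = weight n (inc \<beta> j k) * f (inc \<beta> j k)"
proof -
  have *: "weight n \<gamma> = fact (\<gamma> j) * (\<Prod>i\<in>{..<n} - {j}. fact (\<gamma> i))" for \<gamma>
    unfolding weight_def using assms by (intro prod.remove) auto
  have "(\<Prod>i\<in>{..<n} - {j}. fact (inc \<beta> j k i)) = (\<Prod>i\<in>{..<n} - {j}. fact (\<beta> i) :: real)"
    by (intro prod.cong) (auto simp: inc_apply)
  then show ?thesis
    using fact_pd_power[of \<beta> j k f] by (simp add: * inc_apply mult_ac)
qed

lemma Sn_harmonic_iff: "Sn_harmonic n (\<omega> J) \<longleftrightarrow> harm n (normal n \<omega> J)"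
proof -
  have eq: "weight n \<beta> * (\<Sum>i<n. (pd i ^^ k) (\<omega> J) \<beta>) = (\<Sum>i<n. normal n \<omega> J (inc \<beta> i k))" for \<beta> k
    by (simp add: sum_distrib_left weight_pd_power normal_def)
  have "(\<Sum>i<n. (pd i ^^ k) (\<omega> J) \<beta>) = 0 \<longleftrightarrow> (\<Sum>i<n. normal n \<omega> J (inc \<beta> i k)) = 0" for \<beta> k
    unfolding eq[symmetric] by (simp add: weight_nonzero)
  then show ?thesis by (simp add: Sn_harmonic_def harm_def)
qed

lemma delta_eq_zero_iff: "delta n l \<omega> = (\<lambda>_ _. 0) \<longleftrightarrow> (\<forall>J \<beta>. contraction n l (normal n \<omega>) J \<beta> = 0)"
proof -
  have "weight n \<beta> * delta n l \<omega> J \<beta>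
      = (\<Sum>j\<in>{..<n} - J. eps J j * (weight n \<beta> * (pd j ^^ l) (\<omega> (insert j J)) \<beta>))" for J \<beta>
    by (simp add: delta_def eps_def sum_distrib_left mult_ac)
  also have "\<dots> J \<beta> = contraction n l (normal n \<omega>) J \<beta>" for J \<beta>
    unfolding contraction_def by (intro sum.cong) (auto simp: weight_pd_power normal_def)
  finally have "delta n l \<omega> J \<beta> = 0 \<longleftrightarrow> contraction n l (normal n \<omega>) J \<beta> = 0" for J \<beta>
    using weight_nonzero by (metis mult_eq_0_iff)
  then show ?thesis by (simp add: fun_eq_iff)
qed

lemma supported_normal_iff:
  "supported n r s (normal n \<omega>) \<longleftrightarrow>
    (\<forall>I. \<omega> I \<noteq> (\<lambda>_. 0) \<longrightarrow> I \<subseteq> {..<n} \<and> card I = s) \<and> (\<forall>I. homog n r (\<omega> I))"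
  unfolding supported_def normal_def homog_def fun_eq_iff mult_eq_0_iff
  using weight_nonzero by blast

text \<open>The weights are invariant under permutations, and evaluating \<open>form_act\<close> at
  images under \<sigma> cancels its inverses.\<close>

lemma alternating_normal_iff:
  "alternating n (normal n \<omega>) \<longleftrightarrow> (\<forall>\<sigma>. \<sigma> permutes {..<n} \<longrightarrow>
      form_act \<sigma> \<omega> = (\<lambda>J \<beta>. of_int (sign \<sigma>) * \<omega> J \<beta>))"
proof -
  have "(\<forall>K \<beta>. normal n \<omega> (\<sigma> ` K) \<beta> = of_int (sign \<sigma>) * inv_sgn \<sigma> K * normal n \<omega> K (\<beta> \<circ> \<sigma>))
      \<longleftrightarrow> form_act \<sigma> \<omega> = (\<lambda>J \<beta>. of_int (sign \<sigma>) * \<omega> J \<beta>)" if \<sigma>: "\<sigma> permutes {..<n}" for \<sigma>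
  proof -
    have K: "inv \<sigma> ` (\<sigma> ` K) = K" for K
      using permutes_inverses[OF \<sigma>] by (simp add: image_image)
    have J: "\<sigma> ` (inv \<sigma> ` J) = J" for J
      using permutes_inverses[OF \<sigma>] by (simp add: image_image)
    have swap: "x = of_int (sign \<sigma>) * a * y \<longleftrightarrow> a * y = of_int (sign \<sigma>) * x" for x a y :: real
      by (auto simp: sign_def)
    have "form_act \<sigma> \<omega> = (\<lambda>J \<beta>. of_int (sign \<sigma>) * \<omega> J \<beta>) \<longleftrightarrow>
        (\<forall>K \<beta>. form_act \<sigma> \<omega> (\<sigma> ` K) \<beta> = of_int (sign \<sigma>) * \<omega> (\<sigma> ` K) \<beta>)"
      unfolding fun_eq_iff by (metis J)
    also have "\<dots> \<longleftrightarrow> (\<forall>K \<beta>. \<omega> (\<sigma> ` K) \<beta> = of_int (sign \<sigma>) * inv_sgn \<sigma> K * \<omega> K (\<beta> \<circ> \<sigma>))"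
      by (simp add: form_act_def K swap inv_sgn_def)
    also have "\<dots> \<longleftrightarrow> (\<forall>K \<beta>. normal n \<omega> (\<sigma> ` K) \<beta>
        = of_int (sign \<sigma>) * inv_sgn \<sigma> K * normal n \<omega> K (\<beta> \<circ> \<sigma>))"
      using weight_nonzero[of n] by (simp add: normal_def weight_permute[OF \<sigma>] mult.left_commute)
    finally show ?thesis by simp
  qed
  then show ?thesis unfolding alternating_def by blast
qed

lemma sign_part_iff: "\<omega> \<in> sign_part n r s \<longleftrightarrow> normal n \<omega> \<in> sign_harmonics n r s"
  unfolding sign_part_def H_def sign_harmonics_def mem_Collect_eq Sn_harmonic_iff delta_eq_zero_iff
    supported_normal_iff alternating_normal_iff
  by blast

section \<open>The dimension\<close>

interpretation forms: vector_space form_scale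
  by unfold_locales (auto simp: form_scale_def fun_eq_iff algebra_simps)

lemma sum_form_apply: "(\<Sum>x\<in>A. g x :: rform) J \<alpha> = (\<Sum>x\<in>A. g x J \<alpha>)"
  by (induction A rule: infinite_finite_induct) auto

lemma subspace_sign_part: "forms.subspace (sign_part n r s)"
proof (rule forms.subspaceI)
  show "0 \<in> sign_part n r s"
    by (simp add: sign_part_iff sign_harmonics_def supported_def harm_def contraction_def
        alternating_def normal_def)
next
  fix v w assume vw: "v \<in> sign_part n r s" "w \<in> sign_part n r s"
  have eq: "normal n (v + w) J \<alpha> = normal n v J \<alpha> + normal n w J \<alpha>" for J \<alpha>
    by (simp add: normal_def distrib_left)
  have "supported n r s (normal n (v + w))"
    using vw unfolding sign_part_iff sign_harmonics_def supported_def eq mem_Collect_eq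
    by (metis add.right_neutral)
  moreover have "contraction n l (normal n (v + w)) J \<beta>
      = contraction n l (normal n v) J \<beta> + contraction n l (normal n w) J \<beta>" for l J \<beta>
    by (simp add: contraction_def eq distrib_left sum.distrib)
  ultimately show "v + w \<in> sign_part n r s"
    using vw by (simp add: sign_part_iff sign_harmonics_def harm_def eq sum.distrib
        alternating_def distrib_left)
next
  fix a v assume v: "v \<in> sign_part n r s"
  have eq: "normal n (form_scale a v) J \<alpha> = a * normal n v J \<alpha>" for J \<alpha>
    by (simp add: normal_def form_scale_def)
  have "supported n r s (normal n (form_scale a v))"
    using v unfolding sign_part_iff sign_harmonics_def supported_def eq mem_Collect_eq
    by (metis mult_zero_right)
  moreover have "contraction n l (normal n (form_scale a v)) J \<beta>
      = a * contraction n l (normal n v) J \<beta>" for l J \<beta>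
    by (simp add: contraction_def eq sum_distrib_left mult.left_commute)
  ultimately show "form_scale a v \<in> sign_part n r s"
    using v by (simp add: sign_part_iff sign_harmonics_def harm_def eq
        alternating_def flip: sum_distrib_left)
qed

text \<open>These I index the forms d_I \<Delta> of bidegree (r, s); \<Delta> has degree
  \<open>\<Sum>{..<n}\<close>, and the additive form avoids truncated subtraction.\<close>

definition sign_index :: "nat \<Rightarrow> nat \<Rightarrow> nat \<Rightarrow> nat set set" where
  "sign_index n r s = {I. I \<subseteq> {1..<n} \<and> card I = s \<and> r + \<Sum>I = \<Sum>{..<n}}"

definition sign_basis :: "nat \<Rightarrow> nat set \<Rightarrow> rform" where
  "sign_basis n I J \<alpha> = descendant n (sorted_list_of_set I) J \<alpha> / weight n \<alpha>"

text \<open>Any choice of bijection serves: permuting the positions in \<open>{s..<n}\<close>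
  changes the tested coefficient of an alternating form only by a sign.\<close>

definition test_exponent :: "nat \<Rightarrow> nat \<Rightarrow> nat set \<Rightarrow> nat \<Rightarrow> nat" where
  "test_exponent n s I = (SOME \<alpha>. (\<forall>i. i \<notin> {s..<n} \<longrightarrow> \<alpha> i = 0) \<and> bij_betw \<alpha> {s..<n} ({..<n} - I))"

lemma finite_sign_index: "finite (sign_index n r s)"
  by (rule finite_subset[of _ "Pow {1..<n}"]) (auto simp: sign_index_def)

lemma sign_index_le:
  assumes "I \<in> sign_index n r s"
  shows "s \<le> n"
proof -
  have "card I \<le> card {1..<n}" using assms by (intro card_mono) (auto simp: sign_index_def)
  then show ?thesis using assms by (simp add: sign_index_def)
qed

lemma test_exponent:
  assumes I: "I \<in> sign_index n r s"
  shows "i \<notin> {s..<n} \<Longrightarrow> test_exponent n s I i = 0"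
    and "bij_betw (test_exponent n s I) {s..<n} ({..<n} - I)"
proof -
  have sub: "I \<subseteq> {..<n}" using I by (auto simp: sign_index_def)
  have "finite I" by (rule finite_subset[OF sub]) simp
  then have "card {s..<n} = card ({..<n} - I)"
    using I sub by (simp add: card_Diff_subset sign_index_def)
  then obtain f where f: "bij_betw f {s..<n} ({..<n} - I)"
    using finite_same_card_bij[of "{s..<n}" "{..<n} - I"] by auto
  let ?f = "\<lambda>i. if i \<in> {s..<n} then f i else 0"
  have "bij_betw ?f {s..<n} ({..<n} - I)"
    using f by (subst bij_betw_cong[of _ _ f]) auto
  then have "\<exists>\<alpha>. (\<forall>i. i \<notin> {s..<n} \<longrightarrow> \<alpha> i = 0) \<and> bij_betw \<alpha> {s..<n} ({..<n} - I)"
    by (intro exI[of _ ?f]) auto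
  from someI_ex[OF this] show "i \<notin> {s..<n} \<Longrightarrow> test_exponent n s I i = 0"
    and "bij_betw (test_exponent n s I) {s..<n} ({..<n} - I)"
    unfolding test_exponent_def by blast+
qed

lemma normal_sign_basis: "normal n (sign_basis n I) = descendant n (sorted_list_of_set I)"
  by (simp add: fun_eq_iff normal_def sign_basis_def weight_nonzero)

lemma sign_basis_in_sign_part:
  assumes "I \<in> sign_index n r s"
  shows "sign_basis n I \<in> sign_part n r s"
proof -
  have "finite I" "\<forall>k\<in>I. 1 \<le> k" using assms by (auto simp: sign_index_def intro: finite_subset)
  moreover have "sum_list (sorted_list_of_set I) = \<Sum>I"
    using sum_list_distinct_conv_sum_set[of "sorted_list_of_set I" "\<lambda>x. x"] \<open>finite I\<close> by simp
  ultimately show ?thesis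
    using descendant_sign_harmonics[of "sorted_list_of_set I" r n] assms
    by (simp add: sign_part_iff normal_sign_basis sign_index_def)
qed

text \<open>The test exponent takes the values outside I', while
  \<open>descendant_nonzero_iff\<close> asks for those outside I. The matrix of test coefficients is
  thus diagonal and invertible.\<close>

lemma sign_basis_dual:
  assumes I: "I \<in> sign_index n r s" and I': "I' \<in> sign_index n r s"
  shows "sign_basis n I {..<s} (test_exponent n s I') \<noteq> 0 \<longleftrightarrow> I = I'"
proof -
  note s = sign_index_le[OF I]
  note t = test_exponent[OF I']
  have fin: "finite I" and sub: "I \<subseteq> {..<n}" "I' \<subseteq> {..<n}" and card: "card I = s"
    using assms by (auto simp: sign_index_def intro: finite_subset)
  have compl: "{..<n} - {..<s} = {s..<n}" by auto
  have "sign_basis n I {..<s} (test_exponent n s I') \<noteq> 0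
      \<longleftrightarrow> descendant n (sorted_list_of_set I) {..<s} (test_exponent n s I') \<noteq> 0"
    by (simp add: sign_basis_def weight_nonzero)
  also have "\<dots> \<longleftrightarrow> card {..<s} = length (sorted_list_of_set I)
      \<and> bij_betw (test_exponent n s I') ({..<n} - {..<s}) ({..<n} - set (sorted_list_of_set I))"
    using s t(1) sub fin by (intro descendant_nonzero_iff) auto
  also have "\<dots> \<longleftrightarrow> bij_betw (test_exponent n s I') {s..<n} ({..<n} - I)"
    using fin card by (simp add: compl)
  also have "\<dots> \<longleftrightarrow> I = I'"
  proof
    assume "bij_betw (test_exponent n s I') {s..<n} ({..<n} - I)"
    then have "{..<n} - I = {..<n} - I'" using t(2) by (auto simp: bij_betw_def)
    then show "I = I'" using sub by blast
  qed (use t(2) in auto)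
  finally show ?thesis .
qed

text \<open>An exponent left by \<open>sign_harmonics_eq_zero\<close> is a test exponent up to
  permuting positions. Its I is the set of missed values, and the presence of the value 0 puts I
  inside \<open>{1..<n}\<close>.\<close>

lemma sign_part_eq_zero:
  assumes n: "1 \<le> n" and v: "v \<in> sign_part n r s"
    and zero: "\<And>I. I \<in> sign_index n r s \<Longrightarrow> v {..<s} (test_exponent n s I) = 0"
  shows "v = 0"
proof -
  let ?c = "normal n v"
  have c: "?c \<in> sign_harmonics n r s" using v by (simp add: sign_part_iff)
  then have alt: "alternating n ?c" by (simp add: sign_harmonics_def)
  have "?c J \<alpha> = 0" for J \<alpha>
  proof (rule sign_harmonics_eq_zero[OF c n])
    fix \<alpha> assume s: "s \<le> n" and low: "\<forall>i<s. \<alpha> i = 0" and high: "\<forall>i\<ge>n. \<alpha> i = 0"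
      and inj: "inj_on \<alpha> {s..<n}" and sub: "\<alpha> ` {s..<n} \<subseteq> {..<n}" and "0 \<in> \<alpha> ` {s..<n}"
      and sum: "(\<Sum>i<n. \<alpha> i) = r"
    define I where "I = {..<n} - \<alpha> ` {s..<n}"
    have compl: "{..<n} - I = \<alpha> ` {s..<n}" using sub by (auto simp: I_def)
    have "I \<subseteq> {1..<n}"
    proof
      fix i assume "i \<in> I"
      then have "i < n" "i \<noteq> 0" using \<open>0 \<in> \<alpha> ` {s..<n}\<close> by (auto simp: I_def)
      then show "i \<in> {1..<n}" by simp
    qed
    moreover have "card I = s"
      using sub s inj by (simp add: I_def card_Diff_subset card_image)
    moreover have "r + \<Sum>I = \<Sum>{..<n}"
    proof -
      have "\<Sum>{..<n} = \<Sum>I + \<Sum>(\<alpha> ` {s..<n})"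
        unfolding I_def by (rule sum.subset_diff[OF sub]) simp
      also have "\<Sum>(\<alpha> ` {s..<n}) = (\<Sum>i\<in>{s..<n}. \<alpha> i)"
        using inj by (simp add: sum.reindex)
      also have "\<dots> = (\<Sum>i<n. \<alpha> i)"
        using low by (intro sum.mono_neutral_left) auto
      finally show ?thesis using sum by simp
    qed
    ultimately have I: "I \<in> sign_index n r s" by (simp add: sign_index_def)
    note t = test_exponent[OF I]
    let ?t = "test_exponent n s I"
    \<comment> \<open>Send each position to the one where the test exponent has the value of
      \<alpha>; positions below s stay fixed, so dx_0 \<and> ... \<and> dx_{s-1} is
      unchanged.\<close>
    define \<sigma> where "\<sigma> = (\<lambda>i. if i \<in> {s..<n} then inv_into {s..<n} ?t (\<alpha> i) else i)"
    have "bij_betw (inv_into {s..<n} ?t \<circ> \<alpha>) {s..<n} {s..<n}"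
      using bij_betw_trans[OF inj_on_imp_bij_betw[OF inj]] bij_betw_inv_into[OF t(2)]
      by (simp add: compl)
    then have "bij_betw \<sigma> {s..<n} {s..<n}"
      by (subst bij_betw_cong[of _ _ "inv_into {s..<n} ?t \<circ> \<alpha>"]) (auto simp: \<sigma>_def)
    then have "\<sigma> permutes {s..<n}" by (rule bij_imp_permutes) (auto simp: \<sigma>_def)
    then have \<sigma>: "\<sigma> permutes {..<n}" by (rule permutes_subset) auto
    have img: "\<sigma> ` {..<s} = {..<s}" by (auto simp: \<sigma>_def image_iff)
    have "?t \<circ> \<sigma> = \<alpha>"
    proof
      fix i
      show "(?t \<circ> \<sigma>) i = \<alpha> i"
      proof (cases "i \<in> {s..<n}")
        case True
        then have "\<alpha> i \<in> ?t ` {s..<n}" using t(2) compl by (auto simp: bij_betw_def)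
        then show ?thesis using True by (simp add: \<sigma>_def f_inv_into_f)
      next
        case False
        then show ?thesis using t(1)[OF False] low high by (auto simp: \<sigma>_def not_less)
      qed
    qed
    then have "?c {..<s} ?t = of_int (sign \<sigma>) * inv_sgn \<sigma> {..<s} * ?c {..<s} \<alpha>"
      using alternatingD[OF alt \<sigma>, of "{..<s}" ?t] by (simp add: img)
    moreover have "?c {..<s} ?t = 0" using zero[OF I] by (simp add: normal_def)
    ultimately show "?c {..<s} \<alpha> = 0" by (simp add: inv_sgn_nonzero sign_def split: if_splits)
  qed
  then show ?thesis by (simp add: fun_eq_iff normal_def weight_nonzero)
qed

lemma form_dim_sign_part:
  assumes n: "1 \<le> n"
  shows "form_dim (sign_part n r s) = card (sign_index n r s)"
proof -
  let ?X = "sign_index n r s" and ?b = "sign_basis n" and ?t = "test_exponent n s"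
  have b0: "?b I {..<s} (?t I') = 0" if "I \<in> ?X" "I' \<in> ?X" "I \<noteq> I'" for I I'
    using sign_basis_dual[OF that(1,2)] that(3) by auto
  have b1: "?b I {..<s} (?t I) \<noteq> 0" if "I \<in> ?X" for I
    using sign_basis_dual[OF that that] by auto
  have inj: "inj_on ?b ?X"
    by (rule inj_onI) (metis b0 b1)
  have "\<not> forms.dependent (?b ` ?X)"
  proof (rule forms.independent_if_scalars_zero)
    fix f x assume sum: "(\<Sum>x\<in>?b ` ?X. form_scale (f x) x) = 0" and "x \<in> ?b ` ?X"
    then obtain I where I: "I \<in> ?X" "x = ?b I" by auto
    have "0 = (\<Sum>x\<in>?b ` ?X. form_scale (f x) x) {..<s} (?t I)" by (simp add: sum)
    also have "\<dots> = (\<Sum>I'\<in>?X. f (?b I') * ?b I' {..<s} (?t I))"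
      by (simp add: sum_form_apply form_scale_def sum.reindex[OF inj])
    also have "\<dots> = (\<Sum>I'\<in>{I}. f (?b I') * ?b I' {..<s} (?t I))"
      using I b0 finite_sign_index by (intro sum.mono_neutral_right) auto
    finally show "f x = 0" using b1[OF I(1)] I by simp
  qed (simp add: finite_sign_index)
  moreover have sub: "?b ` ?X \<subseteq> sign_part n r s"
    using sign_basis_in_sign_part by auto
  moreover have "sign_part n r s \<subseteq> forms.span (?b ` ?X)"
  proof
    fix v assume v: "v \<in> sign_part n r s"
    \<comment> \<open>Interpolation: by diagonality w has the same test coefficients as v.\<close>
    define w where "w = (\<Sum>I\<in>?X. form_scale (v {..<s} (?t I) / ?b I {..<s} (?t I)) (?b I))"
    have "w \<in> sign_part n r s"
      unfolding w_def using sub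
      by (intro forms.subspace_sum forms.subspace_scale subspace_sign_part) auto
    then have diff: "v - w \<in> sign_part n r s"
      using v by (intro forms.subspace_diff subspace_sign_part)
    have "v - w = 0"
    proof (rule sign_part_eq_zero[OF n diff])
      fix I assume I: "I \<in> ?X"
      have "w {..<s} (?t I)
          = (\<Sum>I'\<in>{I}. v {..<s} (?t I') / ?b I' {..<s} (?t I') * ?b I' {..<s} (?t I))"
        unfolding w_def sum_form_apply form_scale_def using I b0 finite_sign_index
        by (intro sum.mono_neutral_right) auto
      then show "(v - w) {..<s} (?t I) = 0" using b1[OF I] by simp
    qed
    moreover have "w \<in> forms.span (?b ` ?X)"
      unfolding w_def by (intro forms.span_sum forms.span_scale forms.span_base) auto
    ultimately show "v \<in> forms.span (?b ` ?X)" by simp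
  qed
  ultimately have "forms.dim (sign_part n r s) = card (?b ` ?X)"
    using forms.basis_card_eq_dim by metis
  then show ?thesis by (simp add: form_dim_def card_image[OF inj])
qed

section \<open>The generating function: outer variable t, inner variable q\<close>

lemma coeff_product_eq_card:
  "coeff (coeff (\<Prod>j\<in>{1..<n}. [: monom 1 j, 1 :] :: real poly poly) s) r
    = real (card (sign_index n r s))"
proof -
  let ?A = "{1..<n}"
  have prod_const: "(\<Prod>j\<in>B. [:monom 1 j:]) = ([:monom 1 (\<Sum>B):] :: real poly poly)" for B
    by (induction B rule: infinite_finite_induct)
      (auto simp: mult_monom one_pCons[symmetric] monom_eq_1 pCons_one add.commute)
  have "(\<Prod>j\<in>?A. [: monom 1 j, 1 :] :: real poly poly) = (\<Prod>j\<in>?A. monom 1 1 + [:monom 1 j:])"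
    by (simp add: monom_altdef)
  \<comment> \<open>B collects the factors that contribute t; the others contribute q^j.\<close>
  also have "\<dots> = (\<Sum>B\<in>Pow ?A. (\<Prod>j\<in>B. monom 1 1) * (\<Prod>j\<in>?A - B. [:monom 1 j:]))"
    by (rule prod_add) simp
  also have "\<dots> = (\<Sum>B\<in>Pow ?A. smult (monom 1 (\<Sum>(?A - B))) (monom 1 (card B)))"
    by (simp add: prod_const monom_power mult.commute)
  finally have "coeff (coeff (\<Prod>j\<in>?A. [: monom 1 j, 1 :] :: real poly poly) s) r
      = (\<Sum>B\<in>Pow ?A. if card B = s \<and> \<Sum>(?A - B) = r then 1 else 0)"
    by (simp add: coeff_sum) (auto intro!: sum.cong)
  also have "\<dots> = real (card {B\<in>Pow ?A. card B = s \<and> \<Sum>(?A - B) = r})"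
    by (simp add: sum.inter_filter[symmetric])
  also have "{B\<in>Pow ?A. card B = s \<and> \<Sum>(?A - B) = r} = sign_index n r s"
  proof -
    \<comment> \<open>The index 0 adds nothing, so the condition on the complement of B becomes the
      degree condition of \<open>sign_index\<close>.\<close>
    have "\<Sum>{..<n} = \<Sum>?A"
      by (rule sum.mono_neutral_right) auto
    then have "\<Sum>(?A - B) = r \<longleftrightarrow> r + \<Sum>B = \<Sum>{..<n}" if "B \<subseteq> ?A" for B
      using sum.subset_diff[OF that, of "\<lambda>x. x"] by auto
    then show ?thesis by (auto simp: sign_index_def)
  qed
  finally show ?thesis .
qed

theorem theorem13:
  fixes n r s :: nat
  assumes "n \<ge> 1"
  shows "real (form_dim (sign_part n r s))
       = coeff (coeff (\<Prod>j\<in>{1..<n}. [: monom 1 j, 1 :] :: real poly poly) s) r"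
  using assms by (simp only: form_dim_sign_part coeff_product_eq_card)

end
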